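(* Let $m\ge1$, $n_1,\dots,n_m\ge1$, and $\mathbb{X}=\biguplus_{r=1}^{m}\{r\}\times\mathbb{R}^{n_r}$. Suppose the posterior density on $\mathbb{X}$ at time $k-1$ is $f_{k-1|k-1}(r_{k-1},x_{k-1})=f_{k-1|k-1}(r_{k-1})f_{k-1|k-1}(x_{k-1}|r_{k-1})$ with Gaussian state density given each mode, $$f_{k-1|k-1}(x_{k-1}|r_{k-1})=\mathcal{N}\big(x_{k-1};\overline{x}_{k-1|k-1}^{(r_{k-1})},P_{k-1|k-1}^{(r_{k-1})}\big),$$ and that the transition density is $\mu(r_k|r_{k-1})\,\pi(x_k|x_{k-1},r_k,r_{k-1})$ with $$\pi(x_k|x_{k-1},r_k,r_{k-1})=\mathcal{N}\big(x_k;F^{(r_k,r_{k-1})}x_{k-1}+b^{(r_k,r_{k-1})},Q^{(r_k,r_{k-1})}\big).$$ Let $f_{k|k-1}$ be the resulting (exact) predicted density on $\mathbb{X}$. Then, among all densities $q$ on $\mathbb{X}$ of the form $q(r_k,x_k)=q(r_k)\,q(x_k|r_k)$ with $q(\cdot|r_k)$ a Gaussian density on $\mathbb{R}^{n_{r_k}}$ for each mode $r_k$, the Kullback–Leibler divergence $D(f_{k|k-1}\|q)$ is minimised by the density with mode probabilities $$q(r_k)=f_{k|k-1}(r_k)=\sum_{r_{k-1}=1}^{m}\mu(r_k|r_{k-1})f_{k-1|k-1}(r_{k-1})$$ and $q(x_k|r_k)=\mathcal{N}\big(x_k;\overline{x}_{k|k-1}^{(r_k)},P_{k|k-1}^{(r_k)}\big)$,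 where $$\overline{x}_{k|k-1}^{(r_k)}=\sum_{r_{k-1}=1}^{m}\alpha_{k|k-1}^{(r_k,r_{k-1})}\,\overline{x}_{k|k-1}^{(r_k,r_{k-1})},$$ $$P_{k|k-1}^{(r_k)}=\sum_{r_{k-1}=1}^{m}\alpha_{k|k-1}^{(r_k,r_{k-1})}\big(\overline{x}_{k|k-1}^{(r_k,r_{k-1})}-\overline{x}_{k|k-1}^{(r_k)}\big)\big(\overline{x}_{k|k-1}^{(r_k,r_{k-1})}-\overline{x}_{k|k-1}^{(r_k)}\big)^{T}+\sum_{r_{k-1}=1}^{m}\alpha_{k|k-1}^{(r_k,r_{k-1})}P_{k|k-1}^{(r_k,r_{k-1})},$$ with $$\overline{x}_{k|k-1}^{(r_k,r_{k-1})}=F^{(r_k,r_{k-1})}\overline{x}_{k-1|k-1}^{(r_{k-1})}+b^{(r_k,r_{k-1})},$$ $$P_{k|k-1}^{(r_k,r_{k-1})}=F^{(r_k,r_{k-1})}P_{k-1|k-1}^{(r_{k-1})}\big(F^{(r_k,r_{k-1})}\big)^{T}+Q^{(r_k,r_{k-1})},$$ $$\alpha_{k|k-1}^{(r_k,r_{k-1})}=\frac{\mu(r_k|r_{k-1})f_{k-1|k-1}(r_{k-1})}{\sum_{r'=1}^{m}\mu(r_k|r')f_{k-1|k-1}(r')}.$$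
   Context: The target state is $\tilde x=(r,x)\in\mathbb{X}$ with mode $r\in\{1,\dots,m\}$ and kinematic state $x\in\mathbb{R}^{n_r}$; the dimensions $n_r$ may differ between modes. The integral of a function $g$ on $\mathbb{X}$ is $\int_{\mathbb{X}}g(\tilde x)\,d\tilde x=\sum_{r=1}^m\int_{\mathbb{R}^{n_r}}g(r,x)\,dx$. A density on $\mathbb{X}$ is a nonnegative function with integral one; $g(r)=\int g(r,x)\,dx$ is its mode marginal and $g(x|r)$ the conditional density of the state given the mode. Formulas for quantities conditioned on a mode $r_k$ are asserted for those $r_k$ with $f_{k|k-1}(r_k)>0$ (for other modes the conditional is irrelevant). $\mathcal{N}(x;\bar x,P)$ denotes the Gaussian density with mean $\bar x$ and covariance matrix $P$ (symmetric positive definite) evaluated at $x$. $\mu(\cdot|r_{k-1})$ is a probability mass function on $\{1,\dots,m\}$; $F^{(r_k,r_{k-1})}\in\mathbb{R}^{n_{r_k}\times n_{r_{k-1}}}$, $b^{(r_k,r_{k-1})}\in\mathbb{R}^{n_{r_k}}$, $Q^{(r_k,r_{k-1})}\in\mathbb{R}^{n_{r_k}\times n_{r_k}}$. The exact predicted density is given by the Chapman–Kolmogorov equation on $\mathbb{X}$: $f_{k|k-1}(r_k,x_k)=\sum_{r_{k-1}=1}^m\int \mu(r_k|r_{k-1})\pi(x_k|x_{k-1},r_k,r_{k-1})f_{k-1|k-1}(r_{k-1},x_{k-1})\,dx_{k-1}$. The Kullback–Leibler divergence between densities $\pi,q$ on $\mathbb{X}$ is $D(\pi\|q)=\int_{\mathbb{X}}\pi(\tilde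 x)\log\frac{\pi(\tilde x)}{q(\tilde x)}\,d\tilde x=\sum_{r=1}^m\int_{\mathbb{R}^{n_r}}\pi(r,x)\log\frac{\pi(r,x)}{q(r,x)}\,dx$, with $0\log 0=0$. (The density $q$ is the predicted density used by the "VD-IMM filter".) *)

theory Defs
  imports
    "HOL-Probability.Probability"
    "Jordan_Normal_Form.Gauss_Jordan_Elimination"
    "Jordan_Normal_Form.Determinant"
begin

unbundle no vec_syntax
unbundle no inner_syntax

text \<open>
  The dimension of the kinematic state depends on the mode, which is a bound variable, so vectors
  and matrices are those of \<^theory>\<open>Jordan_Normal_Form.Matrix\<close>: the kinematic states of mode \<open>r\<close>
  are the elements of \<open>carrier_vec (n r)\<close>, and a function on the hybrid space is a curried
  function of a mode in \<open>{1..m}\<close> and a vector.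
\<close>

text \<open>Lebesgue (Borel) measure on \<open>carrier_vec d\<close>: the product measure on \<open>{..<d} \<rightarrow>\<^sub>E \<real>\<close>,
  transported along the coordinate bijection.\<close>

definition lborel_vec :: "nat \<Rightarrow> real vec measure" where
  "lborel_vec d = distr (\<Pi>\<^sub>M i\<in>{..<d}. lborel)
     (vimage_algebra (carrier_vec d) (\<lambda>v. \<lambda>i\<in>{..<d}. v $ i) (\<Pi>\<^sub>M i\<in>{..<d}. lborel))
     (Matrix.vec d)"

definition density_on :: "nat \<Rightarrow> (nat \<Rightarrow> nat) \<Rightarrow> (nat \<Rightarrow> real vec \<Rightarrow> real) \<Rightarrow> bool" where
  "density_on m n f \<longleftrightarrow>
     (\<forall>r\<in>{1..m}. f r \<in> borel_measurable (lborel_vec (n r))) \<and>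
     (\<forall>r\<in>{1..m}. \<forall>x\<in>carrier_vec (n r). 0 \<le> f r x) \<and>
     (\<Sum>r=1..m. \<integral>\<^sup>+x. ennreal (f r x) \<partial>lborel_vec (n r)) = 1"

definition mode_marginal :: "(nat \<Rightarrow> nat) \<Rightarrow> (nat \<Rightarrow> real vec \<Rightarrow> real) \<Rightarrow> nat \<Rightarrow> real" where
  "mode_marginal n f r = (\<integral>x. f r x \<partial>lborel_vec (n r))"

definition is_pmf_on :: "nat \<Rightarrow> (nat \<Rightarrow> real) \<Rightarrow> bool" where
  "is_pmf_on m p \<longleftrightarrow> (\<forall>r\<in>{1..m}. 0 \<le> p r) \<and> (\<Sum>r=1..m. p r) = 1"

definition sym_pos_def :: "nat \<Rightarrow> real mat \<Rightarrow> bool" where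
  "sym_pos_def d P \<longleftrightarrow> P \<in> carrier_mat d d \<and> transpose_mat P = P \<and>
     (\<forall>v\<in>carrier_vec d. v \<noteq> 0\<^sub>v d \<longrightarrow> 0 < v \<bullet> (P *\<^sub>v v))"

definition gauss :: "real vec \<Rightarrow> real mat \<Rightarrow> real vec \<Rightarrow> real" where
  "gauss a P x =
     exp (- ((x - a) \<bullet> (the (mat_inverse P) *\<^sub>v (x - a))) / 2)
       / sqrt ((2 * pi) ^ dim_vec a * Determinant.det P)"

text \<open>The factorisation \<open>f(r,x) = f(r) N(x; a r, P r)\<close> says that the conditional density of the
  state given mode \<open>r\<close> is Gaussian; if \<open>f(r) = 0\<close> the parameters for mode \<open>r\<close> are irrelevant.\<close>

definition gaussian_given_mode ::
  "nat \<Rightarrow> (nat \<Rightarrow> nat) \<Rightarrow> (nat \<Rightarrow> real vec) \<Rightarrow> (nat \<Rightarrow> real mat) \<Rightarrow> (nat \<Rightarrow> real vec \<Rightarrow> real) \<Rightarrow> bool"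
where
  "gaussian_given_mode m n a P f \<longleftrightarrow>
     (\<forall>r\<in>{1..m}. a r \<in> carrier_vec (n r) \<and> sym_pos_def (n r) (P r) \<and>
        (\<forall>x\<in>carrier_vec (n r). f r x = mode_marginal n f r * gauss (a r) (P r) x))"

definition mode_gaussian_density :: "nat \<Rightarrow> (nat \<Rightarrow> nat) \<Rightarrow> (nat \<Rightarrow> real vec \<Rightarrow> real) \<Rightarrow> bool" where
  "mode_gaussian_density m n q \<longleftrightarrow>
     density_on m n q \<and> (\<exists>a P. gaussian_given_mode m n a P q)"

definition chapman_kolmogorov ::
  "nat \<Rightarrow> (nat \<Rightarrow> nat) \<Rightarrow> (nat \<Rightarrow> nat \<Rightarrow> real) \<Rightarrow> (nat \<Rightarrow> nat \<Rightarrow> real vec \<Rightarrow> real vec \<Rightarrow> real) \<Rightarrow>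
    (nat \<Rightarrow> real vec \<Rightarrow> real) \<Rightarrow> nat \<Rightarrow> real vec \<Rightarrow> real"
where
  "chapman_kolmogorov m n mu tdens f r x =
     (\<Sum>r'=1..m. \<integral>x'. mu r r' * tdens r r' x x' * f r' x' \<partial>lborel_vec (n r'))"

text \<open>The divergence may be infinite (for instance if \<open>q\<close> gives probability zero to a mode
  that \<open>p\<close> charges), so it is extended-real valued; with the convention \<open>x / 0 = 0\<close> a
  real-valued integral would wrongly give zero there. For densities the negative part of the
  integrand always has a finite integral.\<close>

definition kl_integrand :: "real \<Rightarrow> real \<Rightarrow> ereal" where
  "kl_integrand p q = (if p = 0 then 0 else if q = 0 then \<infinity> else ereal (p * ln (p / q)))"

text \<open>\<^const>\<open>e2ennreal\<close> maps negative numbers to zero.\<close>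

definition ereal_integral :: "'a measure \<Rightarrow> ('a \<Rightarrow> ereal) \<Rightarrow> ereal" where
  "ereal_integral M h =
     enn2ereal (\<integral>\<^sup>+x. e2ennreal (h x) \<partial>M) - enn2ereal (\<integral>\<^sup>+x. e2ennreal (- h x) \<partial>M)"

definition KL_hybrid ::
  "nat \<Rightarrow> (nat \<Rightarrow> nat) \<Rightarrow> (nat \<Rightarrow> real vec \<Rightarrow> real) \<Rightarrow> (nat \<Rightarrow> real vec \<Rightarrow> real) \<Rightarrow> ereal"
where
  "KL_hybrid m n p q =
     (\<Sum>r=1..m. ereal_integral (lborel_vec (n r)) (\<lambda>x. kl_integrand (p r x) (q r x)))"

text \<open>Defined entrywise, since vectors of unrestricted dimension have no \<open>sum\<close>.\<close>

definition lincomb_vec :: "nat \<Rightarrow> ('i \<Rightarrow> real) \<Rightarrow> ('i \<Rightarrow> real vec) \<Rightarrow> 'i set \<Rightarrow> real vec" where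
  "lincomb_vec d c v I = Matrix.vec d (\<lambda>i. \<Sum>k\<in>I. c k * v k $ i)"

definition lincomb_mat :: "nat \<Rightarrow> ('i \<Rightarrow> real) \<Rightarrow> ('i \<Rightarrow> real mat) \<Rightarrow> 'i set \<Rightarrow> real mat" where
  "lincomb_mat d c A I = Matrix.mat d d (\<lambda>(i, j). \<Sum>k\<in>I. c k * A k $$ (i, j))"

definition outer_square :: "real vec \<Rightarrow> real mat" where
  "outer_square v = Matrix.mat (dim_vec v) (dim_vec v) (\<lambda>(i, j). v $ i * v $ j)"

end

theory Submission
  imports Defs
begin

text \<open>
  For a Gaussian \<open>q\<close>, the function \<open>ln q\<close> is a quadratic polynomial, so its expectation depends only
  on the first two moments. If \<open>q\<^sub>0\<close> is the Gaussian with the moments of \<open>p\<close>, this gives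
  \<open>D(p \<parallel> q) - D(p \<parallel> q\<^sub>0) = \<integral> p ln (q\<^sub>0 / q) = \<integral> q\<^sub>0 ln (q\<^sub>0 / q)\<close>, which Gibbs' inequality bounds from below.
  Only the moments of the predicted density are needed, not its closed form: given a pair of modes
  it is the density of \<open>F x' + b + y\<close> for independent Gaussian \<open>x'\<close> and \<open>y\<close>. Gaussian moments
  come from writing a Gaussian as the image \<open>U z + a\<close> of a standard one with \<open>U\<close> upper triangular;
  the change of variables is then a sequence of one-dimensional affine substitutions.
\<close>

section \<open>Lebesgue measure on vectors\<close>

text \<open>The delicate point is the subtraction of the two divergences: both are extended reals,
  and the integrability of \<open>p ln p\<close>, with \<open>p\<close> a sum of Gaussians, is
  nowhere established. So divergences are never subtracted. If the integrand of
  \<open>D(p \<parallel> q)\<close> is not integrable, its negative part still has a finite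
  integral, the divergence is infinite, and nothing remains to be shown. Otherwise
  \<open>p ln (q\<^sub>0 / q)\<close>, integrable because \<open>p\<close> has second moments, is
  subtracted from an integrable function. The modes are coupled only through their probabilities.
  Instead of a chain rule for the divergence, Gibbs' inequality is applied in each mode to the
  unnormalised functions \<open>w q\<^sub>0\<close> and \<open>v q\<close>; it then loses the
  difference of masses. Modes with \<open>w = 0\<close> or \<open>v = 0\<close> are treated
  separately. Moments are attached to measures and not to densities, because \<open>F x' + b\<close>
  has no density when \<open>F\<close> lacks full row rank; only the added noise restores
  one.\<close>

lemma space_lborel_vec [simp]: "space (lborel_vec d) = carrier_vec d"
  by (simp add: lborel_vec_def)

lemma sets_lborel_vec:
  "sets (lborel_vec d) =
     sets (vimage_algebra (carrier_vec d) (\<lambda>v. \<lambda>i\<in>{..<d}. v $ i) (\<Pi>\<^sub>M i\<in>{..<d}. lborel))"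
  by (simp add: lborel_vec_def)

text \<open>The sigma-algebra of \<open>lborel_vec d\<close> is pulled back along the coordinate
  map, so it suffices to test the coordinates.\<close>

lemma measurable_lborel_vecI:
  assumes "\<And>x. x \<in> space M \<Longrightarrow> g x \<in> carrier_vec d"
    and "\<And>i. i < d \<Longrightarrow> (\<lambda>x. g x $ i) \<in> borel_measurable M"
  shows "g \<in> measurable M (lborel_vec d)"
  unfolding measurable_cong_sets[OF refl sets_lborel_vec]
  using assms by (intro measurable_vimage_algebra2 measurable_restrict) auto

lemma measurable_vec_index [measurable (raw)]:
  assumes g: "g \<in> measurable M (lborel_vec d)" and i: "i < d"
  shows "(\<lambda>x. g x $ i) \<in> borel_measurable M"
proof -
  have "(\<lambda>v. \<lambda>i\<in>{..<d}. v $ i) \<in> measurable (lborel_vec d) (\<Pi>\<^sub>M i\<in>{..<d}. (lborel :: real measure))"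
    unfolding measurable_cong_sets[OF sets_lborel_vec refl]
    by (intro measurable_vimage_algebra1) (auto simp: space_PiM)
  moreover have "(\<lambda>w. w i) \<in> measurable (\<Pi>\<^sub>M i\<in>{..<d}. (lborel :: real measure)) borel"
    using measurable_component_singleton[of i "{..<d}" "\<lambda>_. lborel :: real measure"] i by simp
  ultimately have "(\<lambda>v. (\<lambda>i\<in>{..<d}. v $ i) i) \<in> borel_measurable (lborel_vec d)"
    by (rule measurable_compose)
  then have "(\<lambda>v. v $ i) \<in> borel_measurable (lborel_vec d)" using i by simp
  then show ?thesis by (rule measurable_compose[OF g])
qed

lemma measurable_vec [measurable]:
  "Matrix.vec d \<in> measurable (\<Pi>\<^sub>M i\<in>{..<d}. (lborel :: real measure)) (lborel_vec d)"
  by (intro measurable_lborel_vecI) (auto simp: measurable_component_singleton)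

lemma nn_integral_lborel_vec:
  assumes [measurable]: "h \<in> borel_measurable (lborel_vec d)"
  shows "(\<integral>\<^sup>+x. h x \<partial>lborel_vec d) = (\<integral>\<^sup>+z. h (Matrix.vec d z) \<partial>(\<Pi>\<^sub>M i\<in>{..<d}. lborel))"
proof -
  have 1: "Matrix.vec d \<in> measurable (\<Pi>\<^sub>M i\<in>{..<d}. (lborel :: real measure))
     (vimage_algebra (carrier_vec d) (\<lambda>v. \<lambda>i\<in>{..<d}. v $ i) (\<Pi>\<^sub>M i\<in>{..<d}. lborel))"
    using measurable_vec[of d] unfolding measurable_cong_sets[OF refl sets_lborel_vec] .
  show ?thesis
    unfolding lborel_vec_def using assms
    by (intro nn_integral_distr[OF 1]) (simp add: lborel_vec_def)
qed

text \<open>\<open>distr\<close> sees only the space and the measurable sets of its target, so the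
  algebra in the definition can be replaced by \<open>lborel_vec d\<close> itself. In this form the
  general rules for \<open>distr\<close> apply.\<close>

lemma lborel_vec_eq_distr:
  "lborel_vec d = distr (\<Pi>\<^sub>M i\<in>{..<d}. lborel) (lborel_vec d) (Matrix.vec d)"
  unfolding lborel_vec_def by (rule distr_cong) auto

text \<open>An image of a sigma-finite measure need not be sigma-finite. Here the coordinate map
  inverts \<open>Matrix.vec d\<close>, so a countable cover of the function space by sets of finite
  measure pulls back to one of the vectors.\<close>

lemma sigma_finite_lborel_vec: "sigma_finite_measure (lborel_vec d)"
proof -
  interpret product_sigma_finite "\<lambda>_::nat. lborel :: real measure" ..
  interpret finite_product_sigma_finite "\<lambda>_. lborel :: real measure" "{..<d}" by standard simp
  let ?L = "\<Pi>\<^sub>M i\<in>{..<d}. (lborel :: real measure)"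
  let ?c = "\<lambda>v::real vec. \<lambda>i\<in>{..<d}. v $ i"
  from sigma_finite_countable obtain A where A: "countable A" "A \<subseteq> sets ?L" "\<Union>A = space ?L"
    "\<forall>a\<in>A. emeasure ?L a \<noteq> \<infinity>" by blast
  have c: "?c \<in> measurable (lborel_vec d) ?L"
    by (intro measurable_restrict) simp
  show ?thesis
  proof
    let ?B = "(\<lambda>a. ?c -` a \<inter> carrier_vec d) ` A"
    have "emeasure (lborel_vec d) (?c -` a \<inter> carrier_vec d) \<noteq> \<infinity>" if a: "a \<in> A" for a
    proof -
      have aL: "a \<in> sets ?L" using A a by auto
      have "emeasure (lborel_vec d) (?c -` a \<inter> carrier_vec d) =
        emeasure ?L (Matrix.vec d -` (?c -` a \<inter> carrier_vec d) \<inter> space ?L)"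
        using measurable_sets[OF c aL]
        by (subst lborel_vec_eq_distr, subst emeasure_distr) auto
      also have "Matrix.vec d -` (?c -` a \<inter> carrier_vec d) \<inter> space ?L = a"
      proof -
        \<comment> \<open>Elements of the product space are \<open>undefined\<close> outside
          \<open>{..<d}\<close>, which is what the restricted function \<open>?c\<close> returns
          there.\<close>
        have "?c (Matrix.vec d z) = z" if "z \<in> space ?L" for z
          using that by (auto simp: space_PiM PiE_iff extensional_def fun_eq_iff)
        then show ?thesis using sets.sets_into_space[OF aL] by auto
      qed
      finally show ?thesis using A(4) a by metis
    qed
    moreover have "?c v \<in> space ?L" for v by (auto simp: space_PiM)
    then have "\<Union>?B = carrier_vec d" using A(3) by blast
    moreover have "?B \<subseteq> sets (lborel_vec d)"
      using A(2) measurable_sets[OF c] by auto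
    ultimately show "\<exists>B. countable B \<and> B \<subseteq> sets (lborel_vec d) \<and> \<Union>B = space (lborel_vec d) \<and>
      (\<forall>a\<in>B. emeasure (lborel_vec d) a \<noteq> \<infinity>)"
      using A(1) by (intro exI[of _ ?B]) auto
  qed
qed

text \<open>Induction on \<open>d\<close> with the last coordinate integrated outermost. Row
  \<open>d\<close> involves only that coordinate, so its substitution is one-dimensional and yields
  the factor \<open>U d d\<close>. Once it is fixed, the other rows form a triangular map with a
  changed offset; hence \<open>c\<close> must be arbitrary in the induction.\<close>

lemma nn_integral_upper_triangular:
  fixes U :: "nat \<Rightarrow> nat \<Rightarrow> real"
  assumes "\<And>i. i < d \<Longrightarrow> 0 < U i i"
    and "h \<in> borel_measurable (\<Pi>\<^sub>M i\<in>{..<d}. lborel)"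
  shows "(\<integral>\<^sup>+z. h z \<partial>(\<Pi>\<^sub>M i\<in>{..<d}. lborel)) = ennreal (\<Prod>i<d. U i i) *
    (\<integral>\<^sup>+z. h (\<lambda>i\<in>{..<d}. c i + (\<Sum>j\<in>{i..<d}. U i j * z j)) \<partial>(\<Pi>\<^sub>M i\<in>{..<d}. lborel))"
  using assms
proof (induction d arbitrary: c h)
  case 0
  then show ?case by (simp add: PiM_empty nn_integral_count_space_finite)
next
  case (Suc d)
  interpret product_sigma_finite "\<lambda>_::nat. lborel :: real measure" ..
  note [measurable] = Suc.prems(2)
  let ?L = "\<Pi>\<^sub>M i\<in>{..<d}. (lborel :: real measure)"
  let ?S = "\<Pi>\<^sub>M i\<in>{..<Suc d}. (lborel :: real measure)"
  let ?T = "\<lambda>z. \<lambda>i\<in>{..<Suc d}. c i + (\<Sum>j\<in>{i..<Suc d}. U i j * z j)"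
  have ins: "{..<Suc d} = insert d {..<d}" by auto
  have hm: "h \<in> borel_measurable (\<Pi>\<^sub>M i\<in>insert d {..<d}. (lborel :: real measure))"
    using Suc.prems(2) by (simp add: ins)
  have upd: "(\<lambda>x. x(d := y)) \<in> measurable ?L ?S" for y
    unfolding ins by (rule measurable_fun_upd[where J="{..<d}"]) auto
  have T: "?T \<in> measurable ?S ?S"
    by (intro measurable_restrict) (auto intro!: borel_measurable_sum borel_measurable_times
        borel_measurable_add simp: measurable_component_singleton)
  have hT: "(\<lambda>z. h (?T z)) \<in> borel_measurable (\<Pi>\<^sub>M i\<in>insert d {..<d}. (lborel :: real measure))"
    using measurable_compose[OF T Suc.prems(2)] unfolding ins[symmetric] .
  \<comment> \<open>In the rows below \<open>d\<close> the last coordinate contributes only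
    \<open>U i d * y\<close>. The shifted offset is the \<open>c'\<close> at which \<open>IH\<close>
    is used.\<close>
  have Tupd: "?T (x(d := y)) =
     (\<lambda>i\<in>{..<d}. (c i + U i d * y) + (\<Sum>j\<in>{i..<d}. U i j * x j)) (d := c d + U d d * y)" for x y
  proof
    fix i
    show "?T (x(d := y)) i = ((\<lambda>i\<in>{..<d}. (c i + U i d * y) + (\<Sum>j\<in>{i..<d}. U i j * x j))
      (d := c d + U d d * y)) i"
      by (cases "i < d"; cases "i = d") (auto simp: not_less)
  qed
  have [measurable]: "(\<lambda>y. \<integral>\<^sup>+x. h (x(d := y)) \<partial>?L) \<in> borel_measurable lborel"
  proof -
    have "(\<lambda>(y, x). h (x(d := y))) \<in> borel_measurable (lborel \<Otimes>\<^sub>M ?L)"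
    proof -
      have "(\<lambda>p. (snd p)(d := fst p)) \<in> measurable (lborel \<Otimes>\<^sub>M ?L) ?S"
        unfolding ins by (rule measurable_fun_upd[where J="{..<d}"]) auto
      from measurable_compose[OF this Suc.prems(2)] show ?thesis unfolding case_prod_beta' .
    qed
    moreover interpret finite_product_sigma_finite "\<lambda>_. lborel :: real measure" "{..<d}"
      by standard simp
    have "sigma_finite_measure ?L" ..
    ultimately show ?thesis
      using sigma_finite_measure.borel_measurable_nn_integral by blast
  qed
  have IH: "(\<integral>\<^sup>+x. h (x(d := t)) \<partial>?L) = ennreal (\<Prod>i<d. U i i) *
     (\<integral>\<^sup>+x. h ((\<lambda>i\<in>{..<d}. c' i + (\<Sum>j\<in>{i..<d}. U i j * x j)) (d := t)) \<partial>?L)" for t c'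
    using measurable_compose[OF upd Suc.prems(2)] Suc.prems(1)
    by (intro Suc.IH) auto
  have dpos: "0 < U d d" using Suc.prems(1) by simp
  have ppos: "0 \<le> (\<Prod>i<d. U i i)" using Suc.prems(1) by (intro prod_nonneg) (auto simp: less_imp_le)
  have "(\<integral>\<^sup>+z. h z \<partial>?S) = (\<integral>\<^sup>+y. \<integral>\<^sup>+x. h (x(d := y)) \<partial>?L \<partial>lborel)"
    unfolding ins by (rule product_nn_integral_insert_rev) (use hm in auto)
  also have "\<dots> = ennreal (U d d) * (\<integral>\<^sup>+y. \<integral>\<^sup>+x. h (x(d := c d + U d d * y)) \<partial>?L \<partial>lborel)"
    using dpos by (subst nn_integral_real_affine[where c="U d d" and t="c d"]) auto
  also have "(\<lambda>y. \<integral>\<^sup>+x. h (x(d := c d + U d d * y)) \<partial>?L) =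
    (\<lambda>y. ennreal (\<Prod>i<d. U i i) * (\<integral>\<^sup>+x. h (?T (x(d := y))) \<partial>?L))"
    unfolding Tupd by (intro ext IH)
  also have "(\<integral>\<^sup>+y. ennreal (\<Prod>i<d. U i i) * (\<integral>\<^sup>+x. h (?T (x(d := y))) \<partial>?L) \<partial>lborel) =
     ennreal (\<Prod>i<d. U i i) * (\<integral>\<^sup>+y. \<integral>\<^sup>+x. h (?T (x(d := y))) \<partial>?L \<partial>lborel)"
  proof (rule nn_integral_cmult)
    have "(\<lambda>(y, x). h (?T (x(d := y)))) \<in> borel_measurable (lborel \<Otimes>\<^sub>M ?L)"
    proof -
      have "(\<lambda>p. (snd p)(d := fst p)) \<in> measurable (lborel \<Otimes>\<^sub>M ?L) ?S"
        unfolding ins by (rule measurable_fun_upd[where J="{..<d}"]) auto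
      from measurable_compose[OF measurable_compose[OF this T] Suc.prems(2)]
      show ?thesis unfolding case_prod_beta' .
    qed
    moreover interpret finite_product_sigma_finite "\<lambda>_. lborel :: real measure" "{..<d}"
      by standard simp
    have "sigma_finite_measure ?L" ..
    ultimately show "(\<lambda>y. \<integral>\<^sup>+x. h (?T (x(d := y))) \<partial>?L) \<in> borel_measurable lborel"
      using sigma_finite_measure.borel_measurable_nn_integral by blast
  qed
  also have "(\<integral>\<^sup>+y. \<integral>\<^sup>+x. h (?T (x(d := y))) \<partial>?L \<partial>lborel) = (\<integral>\<^sup>+z. h (?T z) \<partial>?S)"
    unfolding ins using hT[unfolded ins] by (intro product_nn_integral_insert_rev[symmetric]) auto
  finally have "(\<integral>\<^sup>+z. h z \<partial>?S) =
    ennreal (U d d) * (ennreal (\<Prod>i<d. U i i) * (\<integral>\<^sup>+z. h (?T z) \<partial>?S))" .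
  moreover have "ennreal (\<Prod>i<Suc d. U i i) = ennreal (U d d) * ennreal (\<Prod>i<d. U i i)"
    using dpos ppos by (simp add: ennreal_mult[symmetric] mult.commute)
  ultimately show ?case by (simp only: mult.assoc)
qed

section \<open>Triangular factorisation of covariance matrices\<close>

lemma scalar_prod_mult_mat_vec:
  fixes A :: "'a :: comm_semiring_0 mat"
  assumes "A \<in> carrier_mat d d" "u \<in> carrier_vec d" "v \<in> carrier_vec d"
  shows "u \<bullet> (A *\<^sub>v v) = (\<Sum>i<d. \<Sum>j<d. u $ i * A $$ (i, j) * v $ j)"
  using assms
  by (auto simp: scalar_prod_def sum_distrib_left atLeast0LessThan mult.assoc intro!: sum.cong)

text \<open>The entrywise form quantifies over plain functions, so that an induction on
  \<open>d\<close> can extend a test vector by one coordinate with a function update.\<close>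

lemma sym_pos_def_iff:
  "sym_pos_def d P \<longleftrightarrow> P \<in> carrier_mat d d \<and> (\<forall>i<d. \<forall>j<d. P $$ (i, j) = P $$ (j, i)) \<and>
     (\<forall>v. (\<exists>i<d. v i \<noteq> 0) \<longrightarrow> 0 < (\<Sum>i<d. \<Sum>j<d. v i * P $$ (i, j) * v j))"
  (is "?l \<longleftrightarrow> ?c \<and> ?s \<and> ?p")
proof (cases ?c)
  case True
  have s: "transpose_mat P = P \<longleftrightarrow> ?s"
    using True by (auto simp: mat_eq_iff)
  have "(\<forall>v\<in>carrier_vec d. v \<noteq> 0\<^sub>v d \<longrightarrow> 0 < v \<bullet> (P *\<^sub>v v)) \<longleftrightarrow> ?p"
  proof (intro iffI allI ballI impI)
    fix v :: "nat \<Rightarrow> real"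
    assume *: "\<forall>v\<in>carrier_vec d. v \<noteq> 0\<^sub>v d \<longrightarrow> 0 < v \<bullet> (P *\<^sub>v v)" and "\<exists>i<d. v i \<noteq> 0"
    then have "Matrix.vec d v \<noteq> 0\<^sub>v d" by (auto simp: vec_eq_iff)
    then have "0 < Matrix.vec d v \<bullet> (P *\<^sub>v Matrix.vec d v)" using * by simp
    then show "0 < (\<Sum>i<d. \<Sum>j<d. v i * P $$ (i, j) * v j)"
      using True by (subst (asm) scalar_prod_mult_mat_vec[where d=d]) auto
  next
    fix v :: "real vec" assume *: ?p and v: "v \<in> carrier_vec d" "v \<noteq> 0\<^sub>v d"
    then have "\<exists>i<d. v $ i \<noteq> 0" by (auto simp: vec_eq_iff)
    then show "0 < v \<bullet> (P *\<^sub>v v)"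
      using * v True by (subst scalar_prod_mult_mat_vec[where d=d]) auto
  qed
  then show ?thesis unfolding sym_pos_def_def s using True by blast
qed (auto simp: sym_pos_def_def)

text \<open>Eliminating the last coordinate first makes the factor upper triangular and keeps the index
  set \<open>{..<d}\<close> an initial segment.\<close>

lemma upper_triangular_factorisation:
  fixes P :: "nat \<Rightarrow> nat \<Rightarrow> real"
  assumes "\<And>i j. i < d \<Longrightarrow> j < d \<Longrightarrow> P i j = P j i"
    and "\<And>v. \<exists>i<d. v i \<noteq> 0 \<Longrightarrow> 0 < (\<Sum>i<d. \<Sum>j<d. v i * P i j * v j)"
  shows "\<exists>U. (\<forall>i<d. 0 < U i i) \<and> (\<forall>i<d. \<forall>j<i. U i j = 0) \<and>
    (\<forall>i<d. \<forall>j<d. P i j = (\<Sum>k<d. U i k * U j k))"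
  using assms
proof (induction d arbitrary: P)
  case 0
  then show ?case by auto
next
  case (Suc d)
  define c where "c = P d d"
  have "0 < (\<Sum>i<Suc d. \<Sum>j<Suc d. (if i = d then 1 else 0) * P i j * (if j = d then 1 else 0))"
    by (rule Suc.prems(2)) (auto intro!: exI[of _ d])
  then have c: "0 < c" by (simp add: c_def)
  \<comment> \<open>\<open>S\<close> is the Schur complement of the pivot \<open>c\<close>.\<close>
  define S where "S i j = P i j - P i d * P j d / c" for i j
  have "0 < (\<Sum>i<d. \<Sum>j<d. v i * S i j * v j)" if v: "\<exists>i<d. v i \<noteq> 0" for v
  proof -
    define s where "s = (\<Sum>i<d. v i * P i d)"
    \<comment> \<open>For fixed \<open>v\<close>, the value \<open>- s / c\<close> of the last
      coordinate minimises the quadratic form of \<open>P\<close>. Completing the square leaves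
      exactly the form of \<open>S\<close> at \<open>v\<close>.\<close>
    define w where "w = v(d := - s / c)"
    have "(\<Sum>i<Suc d. \<Sum>j<Suc d. w i * P i j * w j) =
      (\<Sum>i<d. (\<Sum>j<d. v i * P i j * v j) + v i * P i d * (- s / c)) +
      ((\<Sum>j<d. (- s / c) * P d j * v j) + (- s / c) * c * (- s / c))"
      by (simp add: w_def c_def)
    also have "\<dots> = (\<Sum>i<d. \<Sum>j<d. v i * P i j * v j) + s * (- s / c) +
      ((\<Sum>j<d. (- s / c) * P d j * v j) + (- s / c) * c * (- s / c))"
      by (simp only: sum.distrib sum_distrib_right[symmetric] s_def[symmetric])
    also have "(\<Sum>j<d. (- s / c) * P d j * v j) = (- s / c) * s"
      unfolding s_def sum_distrib_left
      by (intro sum.cong refl) (auto simp: Suc.prems(1)[of d] ac_simps)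
    also have "(\<Sum>i<d. \<Sum>j<d. v i * P i j * v j) + s * (- s / c) + ((- s / c) * s + (- s / c) * c * (- s / c)) =
      (\<Sum>i<d. \<Sum>j<d. v i * P i j * v j) - s * s / c"
      using c by (simp add: field_simps)
    also have "s * s / c = (\<Sum>i<d. \<Sum>j<d. v i * (P i d * P j d / c) * v j)"
      unfolding s_def sum_product sum_divide_distrib
      by (intro sum.cong refl) (simp add: field_simps)
    also have "(\<Sum>i<d. \<Sum>j<d. v i * P i j * v j) - \<dots> = (\<Sum>i<d. \<Sum>j<d. v i * S i j * v j)"
      by (simp add: S_def sum_subtractf algebra_simps)
    finally have "(\<Sum>i<Suc d. \<Sum>j<Suc d. w i * P i j * w j) =
      (\<Sum>i<d. \<Sum>j<d. v i * S i j * v j)" .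
    moreover have "\<exists>i<Suc d. w i \<noteq> 0"
      using v less_SucI unfolding w_def by (metis fun_upd_other nat_less_le)
    ultimately show ?thesis using Suc.prems(2)[of w] by metis
  qed
  moreover have "S i j = S j i" if "i < d" "j < d" for i j
    using Suc.prems(1)[of i j] that by (simp add: S_def)
  ultimately obtain U where U: "\<forall>i<d. 0 < U i i" "\<forall>i<d. \<forall>j<i. U i j = 0"
    "\<forall>i<d. \<forall>j<d. S i j = (\<Sum>k<d. U i k * U j k)"
    using Suc.IH[of S] by blast
  \<comment> \<open>The factor \<open>U\<close> of \<open>S\<close> is bordered by a zero row and by
    the column \<open>P i d / sqrt c\<close>, whose outer square is the part subtracted in
    \<open>S\<close>. Its bottom entry is \<open>c / sqrt c\<close>, that is
    \<open>sqrt c\<close>.\<close>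
  define V where "V i j = (if j = d then P i d / sqrt c else if i = d then 0 else U i j)" for i j
  have sc: "sqrt c * sqrt c = c" "0 < sqrt c" using c by auto
  have "P i j = (\<Sum>k<Suc d. V i k * V j k)" if "i < Suc d" "j < Suc d" for i j
  proof -
    have "(\<Sum>k<Suc d. V i k * V j k) =
      (\<Sum>k<d. (if i = d then 0 else U i k) * (if j = d then 0 else U j k)) + P i d * P j d / c"
      using sc by (simp add: V_def)
    also have "\<dots> = P i j"
    proof (cases "i = d \<or> j = d")
      case True
      then show ?thesis using Suc.prems(1)[of i j] that c by (auto simp: c_def)
    next
      case False
      then have "i < d" "j < d" using that by auto
      then have "P i j - P i d * P j d / c = (\<Sum>k<d. U i k * U j k)"
        using U(3) unfolding S_def by blast
      then show ?thesis using False by simp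
    qed
    finally show ?thesis by simp
  qed
  moreover have "\<forall>i<Suc d. 0 < V i i"
    using U(1) c sc(2) by (simp add: V_def c_def[symmetric] less_Suc_eq)
  moreover have "\<forall>i<Suc d. \<forall>j<i. V i j = 0" using U(2) by (auto simp: V_def)
  ultimately show ?case by blast
qed

lemma sym_pos_def_factorisation:
  assumes "sym_pos_def d P"
  obtains U where "U \<in> carrier_mat d d" "\<forall>i<d. 0 < U $$ (i, i)" "upper_triangular U"
    "U * transpose_mat U = P"
proof -
  have P: "P \<in> carrier_mat d d" using assms by (simp add: sym_pos_def_def)
  have "\<exists>V. (\<forall>i<d. 0 < V i i) \<and> (\<forall>i<d. \<forall>j<i. V i j = 0) \<and>
    (\<forall>i<d. \<forall>j<d. P $$ (i, j) = (\<Sum>k<d. V i k * V j k))"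
    using assms[unfolded sym_pos_def_iff]
    by (intro upper_triangular_factorisation) simp_all
  then obtain V where V: "\<forall>i<d. 0 < V i i" "\<forall>i<d. \<forall>j<i. V i j = 0"
    "\<forall>i<d. \<forall>j<d. P $$ (i, j) = (\<Sum>k<d. V i k * V j k)"
    by (elim exE conjE)
  let ?U = "Matrix.mat d d (\<lambda>(i, j). V i j)"
  have "?U * transpose_mat ?U = P"
    using P V(3) by (auto simp: mat_eq_iff scalar_prod_def atLeast0LessThan)
  then show ?thesis using V that[of ?U] by (auto simp: upper_triangular_def)
qed

lemma det_upper_triangular_factor:
  fixes U :: "real mat"
  assumes U: "U \<in> carrier_mat d d" "upper_triangular U"
  shows "Determinant.det (U * transpose_mat U) = (\<Prod>i<d. U $$ (i, i))\<^sup>2"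
proof -
  have "Determinant.det U = (\<Prod>i<d. U $$ (i, i))"
    using det_upper_triangular[OF U(2,1)] U(1) by (simp add: prod_list_diag_prod atLeast0LessThan)
  then show ?thesis
    using U(1) by (simp add: det_mult[of _ d] Determinant.det_transpose[of _ d] power2_eq_square)
qed

lemma the_mat_inverse:
  fixes P :: "'a :: field mat"
  assumes "P \<in> carrier_mat d d" "Determinant.det P \<noteq> 0"
  shows "the (mat_inverse P) \<in> carrier_mat d d" "P * the (mat_inverse P) = 1\<^sub>m d"
    "the (mat_inverse P) * P = 1\<^sub>m d"
proof -
  have "P \<in> Units (ring_mat TYPE('a) d ())"
    by (rule det_non_zero_imp_unit[OF assms])
  then obtain K where "mat_inverse P = Some K"
    using mat_inverse(1)[OF assms(1), of "()"] by (cases "mat_inverse P") auto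
  then show "the (mat_inverse P) \<in> carrier_mat d d" "P * the (mat_inverse P) = 1\<^sub>m d"
    "the (mat_inverse P) * P = 1\<^sub>m d"
    using mat_inverse(2)[OF assms(1)] by auto
qed

lemma det_sym_pos_def:
  assumes "sym_pos_def d P"
  shows "0 < Determinant.det P"
proof -
  obtain U where "U \<in> carrier_mat d d" "\<forall>i<d. 0 < U $$ (i, i)" "upper_triangular U"
    "U * transpose_mat U = P"
    by (rule sym_pos_def_factorisation[OF assms])
  moreover from this have "0 < (\<Prod>i<d. U $$ (i, i))" by (intro prod_pos) auto
  ultimately show ?thesis using det_upper_triangular_factor[of U d] by auto
qed

text \<open>From \<open>U * transpose_mat U = P\<close> the matrix
  \<open>transpose_mat U * the (mat_inverse P)\<close> is a right inverse of \<open>U\<close>. For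
  square matrices it is then a left inverse as well, so conjugating the inverse of \<open>P\<close>
  by \<open>U\<close> gives the identity.\<close>

lemma whitening_quadratic_form:
  fixes U :: "real mat"
  assumes U: "U \<in> carrier_mat d d" and "U * transpose_mat U = P" "Determinant.det P \<noteq> 0"
    and z: "z \<in> carrier_vec d"
  shows "(U *\<^sub>v z) \<bullet> (the (mat_inverse P) *\<^sub>v (U *\<^sub>v z)) = z \<bullet> z"
proof -
  let ?K = "the (mat_inverse P)" and ?T = "transpose_mat U"
  have P: "P \<in> carrier_mat d d" using assms by auto
  note K = the_mat_inverse[OF P assms(3)]
  have "U * (?T * ?K) = 1\<^sub>m d"
    using assms K U by (metis assoc_mult_mat transpose_carrier_mat)
  then have "(?T * ?K) * U = 1\<^sub>m d"
    using mat_mult_left_right_inverse[of U d "?T * ?K"] U K by auto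
  moreover have "(U *\<^sub>v z) \<bullet> (?K *\<^sub>v (U *\<^sub>v z)) = z \<bullet> (?T *\<^sub>v (?K *\<^sub>v (U *\<^sub>v z)))"
  proof -
    have "z \<bullet> (?T *\<^sub>v w) = (U *\<^sub>v z) \<bullet> w" if "w \<in> carrier_vec d" for w
      using transpose_vec_mult_scalar[of U d d z w] U z that
      by (metis comm_scalar_prod mult_mat_vec_carrier transpose_carrier_mat)
    then show ?thesis using K U z by simp
  qed
  moreover have "?T *\<^sub>v (?K *\<^sub>v (U *\<^sub>v z)) = ((?T * ?K) * U) *\<^sub>v z"
    using U K z by (simp add: assoc_mult_mat_vec[of _ d d _ d])
  ultimately show ?thesis using z by simp
qed

section \<open>Gaussian densities as affine images\<close>

definition std_gauss_vec :: "nat \<Rightarrow> real vec measure" where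
  "std_gauss_vec d = density (lborel_vec d) (\<lambda>x. \<Prod>i<d. std_normal_density (x $ i))"

definition gauss_measure :: "real vec \<Rightarrow> real mat \<Rightarrow> real vec measure" where
  "gauss_measure a P = density (lborel_vec (dim_vec a)) (gauss a P)"

text \<open>No carrier condition on \<open>a\<close> or \<open>x\<close> appears: the exponential is
  positive whatever value the form takes on vectors of the wrong dimension. This keeps later
  positivity arguments free of side conditions.\<close>

lemma gauss_pos:
  assumes "sym_pos_def d P"
  shows "0 < gauss a P x"
  using det_sym_pos_def[OF assms] by (simp add: gauss_def)

text \<open>The diagonal product is the Jacobian factor of the substitution. It cancels against the
  normalising constant because \<open>det P\<close> is its square.\<close>

lemma prod_diag_mult_gauss_affine:
  assumes P: "sym_pos_def d P" and U: "U \<in> carrier_mat d d" "\<forall>i<d. 0 < U $$ (i, i)"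
    "upper_triangular U" "U * transpose_mat U = P"
    and a: "a \<in> carrier_vec d" and z: "z \<in> carrier_vec d"
  shows "(\<Prod>i<d. U $$ (i, i)) * gauss a P (U *\<^sub>v z + a) = (\<Prod>i<d. std_normal_density (z $ i))"
proof -
  let ?u = "\<Prod>i<d. U $$ (i, i)"
  have u: "0 < ?u" using U(2) by (intro prod_pos) auto
  have "U *\<^sub>v z + a - a = U *\<^sub>v z" using U(1) a z by (auto simp: vec_eq_iff)
  then have "gauss a P (U *\<^sub>v z + a) = exp (- (z \<bullet> z) / 2) / sqrt ((2 * pi) ^ d * ?u\<^sup>2)"
    using whitening_quadratic_form[OF U(1,4) _ z] det_sym_pos_def[OF P] det_upper_triangular_factor[OF U(1,3)] U(4) a
    by (simp add: gauss_def)
  also have "sqrt ((2 * pi) ^ d * ?u\<^sup>2) = sqrt (2 * pi) ^ d * ?u"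
    using u by (simp only: real_sqrt_mult[of "(2 * pi) ^ d"] real_sqrt_power[of "2 * pi"]
        real_sqrt_abs abs_of_pos)
  also have "exp (- (z \<bullet> z) / 2) = (\<Prod>i<d. exp (- (z $ i)\<^sup>2 / 2))"
  proof -
    have "- (z \<bullet> z) / 2 = (\<Sum>i<d. - (z $ i)\<^sup>2 / 2)"
      using z by (simp add: scalar_prod_def atLeast0LessThan sum_negf sum_divide_distrib power2_eq_square)
    then show ?thesis by (simp add: exp_sum)
  qed
  finally have "gauss a P (U *\<^sub>v z + a) =
    (\<Prod>i<d. exp (- (z $ i)\<^sup>2 / 2)) / (sqrt (2 * pi) ^ d * ?u)" .
  moreover have "w * x = e / s" if "x = e / (s * w)" "0 < w" for x e s w :: real
    using that by simp
  ultimately have "?u * gauss a P (U *\<^sub>v z + a) = (\<Prod>i<d. exp (- (z $ i)\<^sup>2 / 2)) / sqrt (2 * pi) ^ d"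
    using u by blast
  also have "\<dots> = (\<Prod>i<d. exp (- (z $ i)\<^sup>2 / 2) / sqrt (2 * pi))"
    unfolding prod_dividef by (simp only: prod_constant card_lessThan)
  finally show ?thesis unfolding std_normal_density_def by simp
qed

lemma borel_measurable_quadratic_form:
  fixes K :: "real mat"
  assumes g: "g \<in> measurable M (lborel_vec d)" and K: "K \<in> carrier_mat d d"
  shows "(\<lambda>x. g x \<bullet> (K *\<^sub>v g x)) \<in> borel_measurable M"
proof -
  have "(\<lambda>x. \<Sum>i<d. \<Sum>j<d. g x $ i * K $$ (i, j) * g x $ j) \<in> borel_measurable M"
    by (intro borel_measurable_sum borel_measurable_times measurable_vec_index[OF g]) auto
  then show ?thesis
    using measurable_space[OF g] K
    by (subst measurable_cong[OF scalar_prod_mult_mat_vec[where d=d]]) auto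
qed

lemma measurable_minus_vec:
  assumes g: "g \<in> measurable M (lborel_vec d)" and h: "h \<in> measurable M (lborel_vec d)"
  shows "(\<lambda>x. g x - h x) \<in> measurable M (lborel_vec d)"
proof (rule measurable_lborel_vecI)
  show "g x - h x \<in> carrier_vec d" if "x \<in> space M" for x
    using measurable_space[OF g that] measurable_space[OF h that] by auto
  fix i assume i: "i < d"
  have "(\<lambda>x. g x $ i - h x $ i) \<in> borel_measurable M"
    using measurable_vec_index[OF g i] measurable_vec_index[OF h i] by measurable
  then show "(\<lambda>x. (g x - h x) $ i) \<in> borel_measurable M"
    using carrier_vecD[OF measurable_space[OF h, simplified]] i
    by (subst measurable_cong[where g="\<lambda>x. g x $ i - h x $ i"]) simp_all
qed

lemma measurable_plus_vec:
  assumes g: "g \<in> measurable M (lborel_vec d)" and h: "h \<in> measurable M (lborel_vec d)"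
  shows "(\<lambda>x. g x + h x) \<in> measurable M (lborel_vec d)"
proof (rule measurable_lborel_vecI)
  show "g x + h x \<in> carrier_vec d" if "x \<in> space M" for x
    using measurable_space[OF g that] measurable_space[OF h that] by auto
  fix i assume i: "i < d"
  have "(\<lambda>x. g x $ i + h x $ i) \<in> borel_measurable M"
    using measurable_vec_index[OF g i] measurable_vec_index[OF h i] by measurable
  then show "(\<lambda>x. (g x + h x) $ i) \<in> borel_measurable M"
    using carrier_vecD[OF measurable_space[OF h, simplified]] i
    by (subst measurable_cong[where g="\<lambda>x. g x $ i + h x $ i"]) simp_all
qed

lemma measurable_mult_mat_vec:
  assumes g: "g \<in> measurable M (lborel_vec d)" and F: "F \<in> carrier_mat e d"
  shows "(\<lambda>x. F *\<^sub>v g x) \<in> measurable M (lborel_vec e)"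
proof (rule measurable_lborel_vecI)
  show "F *\<^sub>v g x \<in> carrier_vec e" if "x \<in> space M" for x
    using measurable_space[OF g that] F by auto
  fix i assume i: "i < e"
  have "(\<lambda>x. \<Sum>j<d. F $$ (i, j) * g x $ j) \<in> borel_measurable M"
    by (intro borel_measurable_sum borel_measurable_times measurable_vec_index[OF g]) auto
  moreover have "(F *\<^sub>v g x) $ i = (\<Sum>j<d. F $$ (i, j) * g x $ j)" if "x \<in> space M" for x
    using measurable_space[OF g that] i F
    by (auto simp: scalar_prod_def atLeast0LessThan intro!: sum.cong)
  ultimately show "(\<lambda>x. (F *\<^sub>v g x) $ i) \<in> borel_measurable M"
    by (subst measurable_cong) auto
qed

text \<open>The mean may vary with the argument, since the transition density is needed jointly in
  both states and has mean \<open>F *\<^sub>v x' + b\<close>.\<close>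

lemma borel_measurable_gauss:
  assumes P: "sym_pos_def d P"
    and a: "a \<in> measurable M (lborel_vec d)" and g: "g \<in> measurable M (lborel_vec d)"
  shows "(\<lambda>x. gauss (a x) P (g x)) \<in> borel_measurable M"
proof -
  have K: "the (mat_inverse P) \<in> carrier_mat d d"
    using the_mat_inverse[of P d] det_sym_pos_def[OF P] P by (auto simp: sym_pos_def_def)
  note [measurable] = borel_measurable_quadratic_form[OF measurable_minus_vec[OF g a] K]
  have "(\<lambda>x. exp (- ((g x - a x) \<bullet> (the (mat_inverse P) *\<^sub>v (g x - a x))) / 2)
      / sqrt ((2 * pi) ^ d * Determinant.det P)) \<in> borel_measurable M"
    by measurable
  then show ?thesis
    by (rule iffD1[OF measurable_cong, rotated])
      (simp add: gauss_def carrier_vecD[OF measurable_space[OF a, simplified]])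
qed

lemma gauss_measure_eq_distr:
  assumes P: "sym_pos_def d P" and U: "U \<in> carrier_mat d d" "\<forall>i<d. 0 < U $$ (i, i)"
    "upper_triangular U" "U * transpose_mat U = P"
    and a: "a \<in> carrier_vec d"
  shows "gauss_measure a P = distr (std_gauss_vec d) (lborel_vec d) (\<lambda>z. U *\<^sub>v z + a)"
proof (rule measure_eqI)
  show "sets (gauss_measure a P) = sets (distr (std_gauss_vec d) (lborel_vec d) (\<lambda>z. U *\<^sub>v z + a))"
    using a by (simp add: gauss_measure_def)
  fix A assume "A \<in> sets (gauss_measure a P)"
  then have A [measurable]: "A \<in> sets (lborel_vec d)" using a by (simp add: gauss_measure_def)
  let ?L = "\<Pi>\<^sub>M i\<in>{..<d}. (lborel :: real measure)"
  let ?T = "\<lambda>z. U *\<^sub>v z + a"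
  let ?u = "\<Prod>i<d. U $$ (i, i)"
  let ?h = "\<lambda>x. ennreal (gauss a P x) * indicator A x"
  have id: "(\<lambda>x. x) \<in> measurable (lborel_vec d) (lborel_vec d)" by simp
  have T [measurable]: "?T \<in> measurable (lborel_vec d) (lborel_vec d)"
    using a by (intro measurable_plus_vec measurable_mult_mat_vec[OF id] U measurable_const) auto
  have [measurable]: "gauss a P \<in> borel_measurable (lborel_vec d)"
    using borel_measurable_gauss[OF P _ id, of "\<lambda>_. a"] a by simp
  have [measurable]: "(\<lambda>x. \<Prod>i<d. std_normal_density (x $ i)) \<in> borel_measurable (lborel_vec d)"
    by (intro borel_measurable_prod measurable_compose[OF measurable_vec_index[OF id]]) auto
  have u: "0 \<le> ?u" using U(2) by (intro prod_nonneg) (auto simp: less_imp_le)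
  have "emeasure (gauss_measure a P) A = (\<integral>\<^sup>+x. ?h x \<partial>lborel_vec d)"
    using a by (simp add: gauss_measure_def emeasure_density)
  also have "\<dots> = (\<integral>\<^sup>+z. ?h (Matrix.vec d z) \<partial>?L)"
    by (rule nn_integral_lborel_vec) measurable
  also have "\<dots> = ennreal ?u * (\<integral>\<^sup>+z. ?h (Matrix.vec d
      (\<lambda>i\<in>{..<d}. a $ i + (\<Sum>j\<in>{i..<d}. U $$ (i, j) * z j))) \<partial>?L)"
    by (rule nn_integral_upper_triangular[of d "\<lambda>i j. U $$ (i, j)"]) (use U(2) in auto)
  also have "(\<lambda>z. Matrix.vec d (\<lambda>i\<in>{..<d}. a $ i + (\<Sum>j\<in>{i..<d}. U $$ (i, j) * z j))) =
      (\<lambda>z. ?T (Matrix.vec d z))"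
  proof (rule ext, rule eq_vecI)
    fix z i assume "i < dim_vec (?T (Matrix.vec d z))"
    then have i: "i < d" using a by simp
    \<comment> \<open>The entries below the diagonal vanish, so the truncated sum is the full scalar
      product of row \<open>i\<close> with the vector.\<close>
    have "(\<Sum>j\<in>{i..<d}. U $$ (i, j) * z j) = (\<Sum>j\<in>{0..<d}. U $$ (i, j) * z j)"
      using U(1,3) i by (intro sum.mono_neutral_left) (auto simp: upper_triangular_def)
    then show "Matrix.vec d (\<lambda>i\<in>{..<d}. a $ i + (\<Sum>j\<in>{i..<d}. U $$ (i, j) * z j)) $ i =
      ?T (Matrix.vec d z) $ i"
      using i a U(1) by (simp add: scalar_prod_def)
  qed (use a in auto)
  also have "ennreal ?u * (\<integral>\<^sup>+z. ?h (?T (Matrix.vec d z)) \<partial>?L) =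
      (\<integral>\<^sup>+z. ennreal ?u * ?h (?T (Matrix.vec d z)) \<partial>?L)"
    by (rule nn_integral_cmult[symmetric]) measurable
  also have "\<dots> = (\<integral>\<^sup>+x. ennreal ?u * ?h (?T x) \<partial>lborel_vec d)"
    by (rule nn_integral_lborel_vec[symmetric]) measurable
  also have "\<dots> = (\<integral>\<^sup>+x. ennreal (\<Prod>i<d. std_normal_density (x $ i)) *
      indicator (?T -` A \<inter> space (lborel_vec d)) x \<partial>lborel_vec d)"
  proof (rule nn_integral_cong)
    fix x assume x: "x \<in> space (lborel_vec d)"
    have "ennreal ?u * ennreal (gauss a P (?T x)) = ennreal (\<Prod>i<d. std_normal_density (x $ i))"
      using prod_diag_mult_gauss_affine[OF P U a, of x] x u gauss_pos[OF P, of a "?T x"]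
      by (simp add: ennreal_mult[symmetric] less_imp_le)
    then show "ennreal ?u * ?h (?T x) = ennreal (\<Prod>i<d. std_normal_density (x $ i)) *
      indicator (?T -` A \<inter> space (lborel_vec d)) x"
      using x by (simp add: mult.assoc[symmetric] indicator_def)
  qed
  also have "\<dots> = emeasure (std_gauss_vec d) (?T -` A \<inter> space (lborel_vec d))"
    unfolding std_gauss_vec_def by (rule emeasure_density[symmetric]) measurable
  also have "\<dots> = emeasure (distr (std_gauss_vec d) (lborel_vec d) ?T) A"
    by (subst emeasure_distr) (auto simp: std_gauss_vec_def)
  finally show "emeasure (gauss_measure a P) A =
    emeasure (distr (std_gauss_vec d) (lborel_vec d) ?T) A" .
qed

section \<open>First and second moments\<close>

definition has_moments :: "real vec measure \<Rightarrow> nat \<Rightarrow> real vec \<Rightarrow> real mat \<Rightarrow> bool" where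
  "has_moments M d a P \<longleftrightarrow> prob_space M \<and> sets M = sets (lborel_vec d) \<and>
     a \<in> carrier_vec d \<and> P \<in> carrier_mat d d \<and>
     (\<forall>i<d. has_bochner_integral M (\<lambda>x. x $ i) (a $ i)) \<and>
     (\<forall>i<d. \<forall>j<d. has_bochner_integral M (\<lambda>x. x $ i * x $ j) (P $$ (i, j) + a $ i * a $ j))"

lemma has_momentsD:
  assumes "has_moments M d a P"
  shows "prob_space M" "sets M = sets (lborel_vec d)" "space M = carrier_vec d"
    "a \<in> carrier_vec d" "P \<in> carrier_mat d d"
    "\<And>i. i < d \<Longrightarrow> has_bochner_integral M (\<lambda>x. x $ i) (a $ i)"
    "\<And>i j. i < d \<Longrightarrow> j < d \<Longrightarrow>
       has_bochner_integral M (\<lambda>x. x $ i * x $ j) (P $$ (i, j) + a $ i * a $ j)"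
  using assms sets_eq_imp_space_eq[of M "lborel_vec d"] by (auto simp: has_moments_def)

lemma (in prob_space) has_bochner_integral_const_prob: "has_bochner_integral M (\<lambda>_. c :: real) c"
  by (simp add: has_bochner_integral_iff prob_space)

text \<open>The value is built from \<open>a\<close>, \<open>P\<close>, \<open>K\<close> and
  \<open>c\<close> alone, so two measures with equal moments give every such form the same
  expectation.\<close>

lemma has_bochner_integral_quadratic:
  fixes K :: "real mat"
  assumes M: "has_moments M d a P" and K: "K \<in> carrier_mat d d" and c: "c \<in> carrier_vec d"
  shows "has_bochner_integral M (\<lambda>x. (x - c) \<bullet> (K *\<^sub>v (x - c)))
    (\<Sum>i<d. \<Sum>j<d. K $$ (i, j) * (P $$ (i, j) + (a $ i - c $ i) * (a $ j - c $ j)))"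
proof -
  note MD = has_momentsD[OF M]
  interpret prob_space M by (rule MD)
  have "has_bochner_integral M
    (\<lambda>x. K $$ (i, j) * (x $ i * x $ j + (- c $ j) * x $ i + (- c $ i) * x $ j + c $ i * c $ j))
    (K $$ (i, j) * (P $$ (i, j) + a $ i * a $ j + (- c $ j) * a $ i + (- c $ i) * a $ j + c $ i * c $ j))"
    if "i < d" "j < d" for i j
    by (intro has_bochner_integral_mult_right has_bochner_integral_add MD
        has_bochner_integral_const_prob that)
  then have "has_bochner_integral M
    (\<lambda>x. \<Sum>i<d. \<Sum>j<d. K $$ (i, j) * (x $ i * x $ j + (- c $ j) * x $ i + (- c $ i) * x $ j + c $ i * c $ j))
    (\<Sum>i<d. \<Sum>j<d. K $$ (i, j) *
      (P $$ (i, j) + a $ i * a $ j + (- c $ j) * a $ i + (- c $ i) * a $ j + c $ i * c $ j))"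
    by (intro has_bochner_integral_sum) auto
  then show ?thesis
  proof (rule iffD1[OF has_bochner_integral_cong, rotated -1])
    fix x assume "x \<in> space M"
    then have x: "x \<in> carrier_vec d" using MD by simp
    show "(\<Sum>i<d. \<Sum>j<d. K $$ (i, j) * (x $ i * x $ j + (- c $ j) * x $ i + (- c $ i) * x $ j + c $ i * c $ j))
      = (x - c) \<bullet> (K *\<^sub>v (x - c))"
      using x c K by (subst scalar_prod_mult_mat_vec[where d=d])
        (auto simp: algebra_simps intro!: sum.cong)
  qed (auto simp: algebra_simps intro!: sum.cong)
qed

lemma measurable_id_cong:
  "sets M = sets N \<Longrightarrow> (\<lambda>x. x) \<in> measurable M N"
  by (simp add: measurable_ident_sets)

lemma has_momentsI_distr:
  assumes M: "prob_space M" and g: "g \<in> measurable M (lborel_vec d)"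
    and a: "a \<in> carrier_vec d" "P \<in> carrier_mat d d"
    and 1: "\<And>i. i < d \<Longrightarrow> has_bochner_integral M (\<lambda>x. g x $ i) (a $ i)"
    and 2: "\<And>i j. i < d \<Longrightarrow> j < d \<Longrightarrow>
      has_bochner_integral M (\<lambda>x. g x $ i * g x $ j) (P $$ (i, j) + a $ i * a $ j)"
  shows "has_moments (distr M (lborel_vec d) g) d a P"
proof -
  have [measurable]: "(\<lambda>x. x $ i) \<in> borel_measurable (lborel_vec d)" if "i < d" for i
    by (rule measurable_vec_index[OF _ that]) simp
  show ?thesis
    unfolding has_moments_def
    using a g by (auto intro!: prob_space.prob_space_distr M has_bochner_integral_distr 1 2)
qed

text \<open>\<open>F\<close> may be rectangular or of deficient rank. The image can then sit on a
  proper affine subspace, which is why the claim concerns the image measure.\<close>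

lemma has_moments_affine:
  assumes M: "has_moments M d a P" and F: "F \<in> carrier_mat e d" and b: "b \<in> carrier_vec e"
  shows "has_moments (distr M (lborel_vec e) (\<lambda>x. F *\<^sub>v x + b)) e (F *\<^sub>v a + b) (F * P * transpose_mat F)"
proof -
  note MD = has_momentsD[OF M]
  interpret prob_space M by (rule MD)
  have comp: "(F *\<^sub>v x + b) $ i = (\<Sum>k<d. F $$ (i, k) * x $ k) + b $ i"
    if "x \<in> carrier_vec d" "i < e" for x i
    using that F b by (auto simp: scalar_prod_def atLeast0LessThan intro!: sum.cong)
  have lin: "has_bochner_integral M (\<lambda>x. \<Sum>k<d. F $$ (i, k) * x $ k) (\<Sum>k<d. F $$ (i, k) * a $ k)" for i
    by (intro has_bochner_integral_sum has_bochner_integral_mult_right MD) auto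
  show ?thesis
  proof (rule has_momentsI_distr)
    show "(\<lambda>x. F *\<^sub>v x + b) \<in> measurable M (lborel_vec e)"
      using b by (intro measurable_plus_vec measurable_mult_mat_vec[OF measurable_id_cong[OF MD(2)] F]
          measurable_const) simp
  next
    fix i assume i: "i < e"
    have "has_bochner_integral M (\<lambda>x. (\<Sum>k<d. F $$ (i, k) * x $ k) + b $ i)
       ((\<Sum>k<d. F $$ (i, k) * a $ k) + b $ i)"
      by (intro has_bochner_integral_add lin has_bochner_integral_const_prob)
    then show "has_bochner_integral M (\<lambda>x. (F *\<^sub>v x + b) $ i) ((F *\<^sub>v a + b) $ i)"
      by (rule iffD1[OF has_bochner_integral_cong, rotated -1]) (auto simp: comp[OF _ i] MD)
  next
    fix i j assume i: "i < e" and j: "j < e"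
    let ?l = "\<lambda>i x. \<Sum>k<d. F $$ (i, k) * x $ k"
    have Pij: "(F * P * transpose_mat F) $$ (i, j) = (\<Sum>k<d. \<Sum>l<d. F $$ (i, k) * F $$ (j, l) * P $$ (k, l))"
    proof -
      have "(F * P * transpose_mat F) $$ (i, j) =
        (\<Sum>l<d. (\<Sum>k<d. F $$ (i, k) * P $$ (k, l)) * F $$ (j, l))"
        using i j F MD(5) by (auto simp: scalar_prod_def atLeast0LessThan simp del: assoc_mult_mat intro!: sum.cong)
      also have "\<dots> = (\<Sum>l<d. \<Sum>k<d. F $$ (i, k) * F $$ (j, l) * P $$ (k, l))"
        unfolding sum_distrib_right by (intro sum.cong refl) (simp add: ac_simps)
      also have "\<dots> = (\<Sum>k<d. \<Sum>l<d. F $$ (i, k) * F $$ (j, l) * P $$ (k, l))"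
        by (rule sum.swap)
      finally show ?thesis .
    qed
    have "has_bochner_integral M (\<lambda>x. (\<Sum>k<d. \<Sum>l<d. (F $$ (i, k) * F $$ (j, l)) * (x $ k * x $ l))
        + b $ j * ?l i x + b $ i * ?l j x + b $ i * b $ j)
      ((\<Sum>k<d. \<Sum>l<d. (F $$ (i, k) * F $$ (j, l)) * (P $$ (k, l) + a $ k * a $ l))
        + b $ j * ?l i a + b $ i * ?l j a + b $ i * b $ j)"
      by (intro has_bochner_integral_add has_bochner_integral_mult_right lin MD
          has_bochner_integral_sum has_bochner_integral_const_prob) auto
    then show "has_bochner_integral M (\<lambda>x. (F *\<^sub>v x + b) $ i * (F *\<^sub>v x + b) $ j)
      ((F * P * transpose_mat F) $$ (i, j) + (F *\<^sub>v a + b) $ i * (F *\<^sub>v a + b) $ j)"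
    proof (rule iffD1[OF has_bochner_integral_cong, rotated -1])
      have sq: "(\<Sum>k<d. \<Sum>l<d. (F $$ (i, k) * F $$ (j, l)) * (x $ k * x $ l)) = ?l i x * ?l j x" for x
        unfolding sum_product by (intro sum.cong refl) (simp add: ac_simps)
      show "(\<Sum>k<d. \<Sum>l<d. (F $$ (i, k) * F $$ (j, l)) * (x $ k * x $ l))
        + b $ j * ?l i x + b $ i * ?l j x + b $ i * b $ j = (F *\<^sub>v x + b) $ i * (F *\<^sub>v x + b) $ j"
        if "x \<in> space M" for x
        using that unfolding sq MD(3) by (simp only: comp[OF _ i] comp[OF _ j]) (simp add: algebra_simps)
      have "(\<Sum>k<d. \<Sum>l<d. (F $$ (i, k) * F $$ (j, l)) * (P $$ (k, l) + a $ k * a $ l)) =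
        (F * P * transpose_mat F) $$ (i, j) + ?l i a * ?l j a"
        unfolding Pij sq[symmetric] by (simp add: distrib_left sum.distrib)
      then show "(\<Sum>k<d. \<Sum>l<d. (F $$ (i, k) * F $$ (j, l)) * (P $$ (k, l) + a $ k * a $ l))
        + b $ j * ?l i a + b $ i * ?l j a + b $ i * b $ j =
        (F * P * transpose_mat F) $$ (i, j) + (F *\<^sub>v a + b) $ i * (F *\<^sub>v a + b) $ j"
        unfolding comp[OF MD(4) i] comp[OF MD(4) j] by (simp add: algebra_simps)
    qed simp
  qed (use F b MD in auto)
qed

lemma has_bochner_integral_pair_mult:
  fixes f :: "'a \<Rightarrow> real" and g :: "'b \<Rightarrow> real"
  assumes "sigma_finite_measure M" "sigma_finite_measure N"
    and f: "has_bochner_integral M f u" and g: "has_bochner_integral N g v"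
  shows "has_bochner_integral (M \<Otimes>\<^sub>M N) (\<lambda>p. f (fst p) * g (snd p)) (u * v)"
proof -
  interpret pair_sigma_finite M N using assms by (simp add: pair_sigma_finite_def)
  have fi: "integrable M f" "integral\<^sup>L M f = u" and gi: "integrable N g" "integral\<^sup>L N g = v"
    using f g by (auto simp: has_bochner_integral_iff)
  note [measurable] = borel_measurable_integrable[OF fi(1)] borel_measurable_integrable[OF gi(1)]
  have int: "integrable (M \<Otimes>\<^sub>M N) (\<lambda>(x, y). f x * g y)"
  proof (rule Fubini_integrable)
    have "integrable M (\<lambda>x. \<bar>f x\<bar> * (\<integral>y. \<bar>g y\<bar> \<partial>N))" using fi by auto
    then show "integrable M (\<lambda>x. \<integral>y. norm (case (x, y) of (x, y) \<Rightarrow> f x * g y) \<partial>N)"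
      by (simp add: abs_mult)
    show "AE x in M. integrable N (\<lambda>y. case (x, y) of (x, y) \<Rightarrow> f x * g y)" using gi by simp
  qed measurable
  moreover have "integral\<^sup>L (M \<Otimes>\<^sub>M N) (\<lambda>(x, y). f x * g y) = u * v"
    using integral_fst'[OF int] fi gi by simp
  ultimately show ?thesis by (simp add: has_bochner_integral_iff case_prod_beta')
qed

text \<open>Under the product measure the mixed terms have expectation \<open>a $ i * b $ j\<close>,
  the product of the means, so only the covariances add.\<close>

lemma has_moments_indep_sum:
  assumes M: "has_moments M d a P" and N: "has_moments N d b Q"
  shows "has_moments (distr (M \<Otimes>\<^sub>M N) (lborel_vec d) (\<lambda>p. fst p + snd p)) d (a + b) (P + Q)"
proof -
  note MD = has_momentsD[OF M] and ND = has_momentsD[OF N]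
  interpret M: prob_space M by (rule MD)
  interpret N: prob_space N by (rule ND)
  interpret MN: pair_prob_space M N ..
  have sp: "fst p \<in> carrier_vec d" "snd p \<in> carrier_vec d" if "p \<in> space (M \<Otimes>\<^sub>M N)" for p
    using that MD(3) ND(3) by (auto simp: space_pair_measure)
  note pm = has_bochner_integral_pair_mult[OF M.sigma_finite_measure_axioms N.sigma_finite_measure_axioms]
  \<comment> \<open>With the constant 1 as the other factor, functions of a single component become
    instances of the product rule \<open>pm\<close>.\<close>
  note M1 = M.has_bochner_integral_const_prob[of 1] and N1 = N.has_bochner_integral_const_prob[of 1]
  have X: "has_bochner_integral (M \<Otimes>\<^sub>M N) (\<lambda>p. fst p $ i) (a $ i)" if "i < d" for i
    using pm[OF MD(6)[OF that] N1] by simp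
  have Y: "has_bochner_integral (M \<Otimes>\<^sub>M N) (\<lambda>p. snd p $ i) (b $ i)" if "i < d" for i
    using pm[OF M1 ND(6)[OF that]] by simp
  show ?thesis
  proof (rule has_momentsI_distr)
    show "prob_space (M \<Otimes>\<^sub>M N)" by (rule MN.P.prob_space_axioms)
    show "(\<lambda>p. fst p + snd p) \<in> measurable (M \<Otimes>\<^sub>M N) (lborel_vec d)"
    proof (rule measurable_plus_vec)
      show "fst \<in> measurable (M \<Otimes>\<^sub>M N) (lborel_vec d)"
        using measurable_fst[of M N] by (simp add: measurable_cong_sets[OF refl MD(2)])
      show "snd \<in> measurable (M \<Otimes>\<^sub>M N) (lborel_vec d)"
        using measurable_snd[of M N] by (simp add: measurable_cong_sets[OF refl ND(2)])
    qed
  next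
    fix i assume i: "i < d"
    have "has_bochner_integral (M \<Otimes>\<^sub>M N) (\<lambda>p. fst p $ i + snd p $ i) (a $ i + b $ i)"
      by (intro has_bochner_integral_add X Y i)
    then show "has_bochner_integral (M \<Otimes>\<^sub>M N) (\<lambda>p. (fst p + snd p) $ i) ((a + b) $ i)"
      by (rule iffD1[OF has_bochner_integral_cong, rotated -1])
        (use i sp[THEN carrier_vecD] MD(4) ND(4) in \<open>simp_all\<close>)
  next
    fix i j assume i: "i < d" and j: "j < d"
    have XX: "has_bochner_integral (M \<Otimes>\<^sub>M N) (\<lambda>p. fst p $ i * fst p $ j) (P $$ (i, j) + a $ i * a $ j)"
      using pm[OF MD(7)[OF i j] N1] by simp
    have YY: "has_bochner_integral (M \<Otimes>\<^sub>M N) (\<lambda>p. snd p $ i * snd p $ j) (Q $$ (i, j) + b $ i * b $ j)"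
      using pm[OF M1 ND(7)[OF i j]] by simp
    have "has_bochner_integral (M \<Otimes>\<^sub>M N)
      (\<lambda>p. fst p $ i * fst p $ j + fst p $ i * snd p $ j + fst p $ j * snd p $ i + snd p $ i * snd p $ j)
      (P $$ (i, j) + a $ i * a $ j + a $ i * b $ j + a $ j * b $ i + (Q $$ (i, j) + b $ i * b $ j))"
      by (intro has_bochner_integral_add XX YY pm MD(6) ND(6) i j)
    then show "has_bochner_integral (M \<Otimes>\<^sub>M N) (\<lambda>p. (fst p + snd p) $ i * (fst p + snd p) $ j)
      ((P + Q) $$ (i, j) + (a + b) $ i * (a + b) $ j)"
      by (rule iffD1[OF has_bochner_integral_cong, rotated -1])
        (use i j sp[THEN carrier_vecD] MD(4,5) ND(4,5) in \<open>simp_all add: algebra_simps\<close>)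
  qed (use MD ND in auto)
qed

lemma std_normal_moments:
  "has_bochner_integral lborel std_normal_density 1"
  "has_bochner_integral lborel (\<lambda>x. std_normal_density x * x) 0"
  "has_bochner_integral lborel (\<lambda>x. std_normal_density x * x\<^sup>2) 1"
  using std_normal_moment_even[of 0] std_normal_moment_odd[of 0] std_normal_moment_even[of 1]
  by (simp_all add: fact_numeral)

text \<open>Density and integrand both factor over the coordinates. Total mass, means and mixed
  second moments all follow by taking \<open>g i\<close> to be 1 except at the coordinates
  involved.\<close>

lemma has_bochner_integral_std_gauss_prod:
  fixes g :: "nat \<Rightarrow> real \<Rightarrow> real"
  assumes "\<And>i. i < d \<Longrightarrow> has_bochner_integral lborel (\<lambda>x. std_normal_density x * g i x) (c i)"
    and [measurable]: "\<And>i. i < d \<Longrightarrow> g i \<in> borel_measurable borel"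
  shows "has_bochner_integral (std_gauss_vec d) (\<lambda>x. \<Prod>i<d. g i (x $ i)) (\<Prod>i<d. c i)"
proof -
  interpret product_sigma_finite "\<lambda>_::nat. lborel :: real measure" ..
  have id: "(\<lambda>x. x) \<in> measurable (lborel_vec d) (lborel_vec d)" by simp
  have [measurable]: "(\<lambda>x. \<Prod>i<d. std_normal_density (x $ i)) \<in> borel_measurable (lborel_vec d)"
    by (intro borel_measurable_prod measurable_compose[OF measurable_vec_index[OF id]]) auto
  have [measurable]: "(\<lambda>x. \<Prod>i<d. g i (x $ i)) \<in> borel_measurable (lborel_vec d)"
    by (intro borel_measurable_prod measurable_compose[OF measurable_vec_index[OF id]]) auto
  have c: "integrable lborel (\<lambda>x. std_normal_density x * g i x)"
    "integral\<^sup>L lborel (\<lambda>x. std_normal_density x * g i x) = c i" if "i < d" for i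
    using assms(1)[OF that] by (auto simp: has_bochner_integral_iff)
  have "has_bochner_integral (\<Pi>\<^sub>M i\<in>{..<d}. lborel)
    (\<lambda>z. \<Prod>i<d. std_normal_density (z i) * g i (z i)) (\<Prod>i<d. c i)"
    unfolding has_bochner_integral_iff
    using product_integrable_prod[of "{..<d}" "\<lambda>i x. std_normal_density x * g i x"]
      product_integral_prod[of "{..<d}" "\<lambda>i x. std_normal_density x * g i x"] c by simp
  then have "has_bochner_integral (\<Pi>\<^sub>M i\<in>{..<d}. lborel)
    (\<lambda>z. (\<Prod>i<d. std_normal_density (Matrix.vec d z $ i)) *\<^sub>R (\<Prod>i<d. g i (Matrix.vec d z $ i))) (\<Prod>i<d. c i)"
    by (simp add: prod.distrib)
  then have "has_bochner_integral (lborel_vec d)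
    (\<lambda>x. (\<Prod>i<d. std_normal_density (x $ i)) *\<^sub>R (\<Prod>i<d. g i (x $ i))) (\<Prod>i<d. c i)"
    by (subst lborel_vec_eq_distr, intro has_bochner_integral_distr) measurable
  then show ?thesis
    unfolding std_gauss_vec_def
    by (intro has_bochner_integral_density) (auto intro!: prod_nonneg)
qed

lemma has_moments_std_gauss: "has_moments (std_gauss_vec d) d (0\<^sub>v d) (1\<^sub>m d)"
proof -
  note prod = has_bochner_integral_std_gauss_prod
  have "has_bochner_integral (std_gauss_vec d) (\<lambda>x. \<Prod>i<d. 1 :: real) (\<Prod>i<d. 1)"
    by (rule prod) (auto simp: std_normal_moments)
  then have "prob_space (std_gauss_vec d)"
    by (intro prob_spaceI) (auto simp: has_bochner_integral_iff integrable_iff_bounded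
        emeasure_eq_ennreal_measure)
  moreover have "has_bochner_integral (std_gauss_vec d) (\<lambda>x. x $ i) 0" if i: "i < d" for i
  proof -
    have "has_bochner_integral (std_gauss_vec d) (\<lambda>x. \<Prod>k<d. if k = i then x $ k else 1)
      (\<Prod>k<d. if k = i then 0 else 1)"
      by (rule prod[of d "\<lambda>k y. if k = i then y else 1"]) (auto simp: std_normal_moments)
    then show ?thesis using i by simp
  qed
  moreover have "has_bochner_integral (std_gauss_vec d) (\<lambda>x. x $ i * x $ j) (if i = j then 1 else 0)"
    if i: "i < d" and j: "j < d" for i j
  proof -
    have "has_bochner_integral (std_gauss_vec d)
      (\<lambda>x. \<Prod>k<d. (if k = i then x $ k else 1) * (if k = j then x $ k else 1))
      (\<Prod>k<d. if k = i \<and> k = j then 1 else if k = i \<or> k = j then 0 else 1)"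
      by (rule prod[of d "\<lambda>k y. (if k = i then y else 1) * (if k = j then y else 1)"])
        (auto simp: std_normal_moments power2_eq_square[symmetric])
    moreover have "(\<Prod>k<d. if k = i \<and> k = j then 1 else if k = i \<or> k = j then 0 else 1) =
      (if i = j then 1 else 0 :: real)"
      using i j by (auto intro!: prod_zero prod.neutral)
    ultimately show ?thesis using i j by (simp add: prod.distrib)
  qed
  ultimately show ?thesis by (auto simp: has_moments_def std_gauss_vec_def one_mat_def)
qed

lemma has_moments_gauss:
  assumes P: "sym_pos_def d P" and a: "a \<in> carrier_vec d"
  shows "has_moments (gauss_measure a P) d a P"
proof -
  obtain U where U: "U \<in> carrier_mat d d" "\<forall>i<d. 0 < U $$ (i, i)" "upper_triangular U"
    "U * transpose_mat U = P"
    by (rule sym_pos_def_factorisation[OF P])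
  have "U *\<^sub>v 0\<^sub>v d + a = a" using U(1) a by (auto simp: vec_eq_iff)
  moreover have "U * 1\<^sub>m d * transpose_mat U = P" using U(1,4) by simp
  ultimately show ?thesis
    using has_moments_affine[OF has_moments_std_gauss U(1) a] gauss_measure_eq_distr[OF P U a]
    by simp
qed

section \<open>One component of the predicted density\<close>

text \<open>Substituting \<open>w = P^-1 v\<close> turns the form of the inverse at \<open>v\<close>
  into the form of \<open>P\<close> at \<open>w\<close>.\<close>

lemma sym_pos_def_inverse_nonneg:
  assumes P: "sym_pos_def d P" and v: "v \<in> carrier_vec d"
  shows "0 \<le> v \<bullet> (the (mat_inverse P) *\<^sub>v v)"
proof -
  let ?K = "the (mat_inverse P)"
  have Pc: "P \<in> carrier_mat d d" using P by (simp add: sym_pos_def_def)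
  have "Determinant.det P \<noteq> 0" using det_sym_pos_def[OF P] by simp
  note K = the_mat_inverse[OF Pc this]
  define w where "w = ?K *\<^sub>v v"
  have w: "w \<in> carrier_vec d" using K v by (simp add: w_def)
  have Pw: "P *\<^sub>v w = v"
    unfolding w_def using K Pc v by (simp add: assoc_mult_mat_vec[symmetric, of _ d d _ d])
  have "0 \<le> w \<bullet> (P *\<^sub>v w)"
    using P w Pc by (cases "w = 0\<^sub>v d") (auto simp: sym_pos_def_def less_imp_le)
  then show ?thesis
    using Pw w v by (simp add: w_def[symmetric] comm_scalar_prod[of v d w])
qed

text \<open>Supplies the constant that dominates the transition density when the prediction integral
  is shown to be integrable.\<close>

lemma gauss_le:
  assumes P: "sym_pos_def d P" and a: "a \<in> carrier_vec d" and x: "x \<in> carrier_vec d"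
  shows "gauss a P x \<le> 1 / sqrt ((2 * pi) ^ d * Determinant.det P)"
proof -
  have "x - a \<in> carrier_vec d" using a x by simp
  from sym_pos_def_inverse_nonneg[OF P this] show ?thesis
    using det_sym_pos_def[OF P] a by (auto simp: gauss_def intro!: divide_right_mono)
qed

text \<open>One factor \<open>U\<close> serves every mean, so both sides are affine images of the
  same standard Gaussian, and a translation rule for \<open>lborel_vec\<close> is avoided.\<close>

lemma gauss_measure_shift:
  assumes Q: "sym_pos_def d Q" and c: "c \<in> carrier_vec d"
  shows "gauss_measure c Q = distr (gauss_measure (0\<^sub>v d) Q) (lborel_vec d) (\<lambda>y. c + y)"
proof -
  obtain U where U: "U \<in> carrier_mat d d" "\<forall>i<d. 0 < U $$ (i, i)" "upper_triangular U"
    "U * transpose_mat U = Q"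
    by (rule sym_pos_def_factorisation[OF Q])
  have id: "(\<lambda>x. x) \<in> measurable (lborel_vec d) (lborel_vec d)" by simp
  have m: "(\<lambda>z. U *\<^sub>v z + 0\<^sub>v d) \<in> measurable (std_gauss_vec d) (lborel_vec d)"
    unfolding std_gauss_vec_def measurable_density_eq1
    by (intro measurable_plus_vec measurable_mult_mat_vec[OF id U(1)] measurable_const) simp
  have m': "(\<lambda>y. c + y) \<in> measurable (lborel_vec d) (lborel_vec d)"
    by (intro measurable_plus_vec[OF _ id] measurable_const) (simp add: c)
  have "distr (gauss_measure (0\<^sub>v d) Q) (lborel_vec d) (\<lambda>y. c + y) =
    distr (std_gauss_vec d) (lborel_vec d) ((\<lambda>y. c + y) \<circ> (\<lambda>z. U *\<^sub>v z + 0\<^sub>v d))"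
    unfolding gauss_measure_eq_distr[OF Q U zero_carrier_vec] by (rule distr_distr[OF m' m])
  also have "\<dots> = gauss_measure c Q"
    unfolding gauss_measure_eq_distr[OF Q U c]
    by (rule distr_cong) (use U c in \<open>auto simp: std_gauss_vec_def comm_add_vec[of c d]\<close>)
  finally show ?thesis by simp
qed

text \<open>The propagated covariance is only semidefinite in general, since
  \<open>transpose_mat F\<close> may have a kernel; strictness comes from \<open>Q\<close>.\<close>

lemma sym_pos_def_predicted_cov:
  assumes P: "sym_pos_def d P" and Q: "sym_pos_def e Q" and F: "F \<in> carrier_mat e d"
  shows "sym_pos_def e (F * P * transpose_mat F + Q)"
proof -
  let ?T = "transpose_mat F"
  have Pc: "P \<in> carrier_mat d d" "transpose_mat P = P" and Qc: "Q \<in> carrier_mat e e" "transpose_mat Q = Q"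
    using P Q by (auto simp: sym_pos_def_def)
  have T: "?T \<in> carrier_mat d e" using F by simp
  have A: "F * P * ?T \<in> carrier_mat e e" using F Pc by simp
  have "transpose_mat (F * P * ?T + Q) = transpose_mat (F * P * ?T) + transpose_mat Q"
    by (rule transpose_add[OF A Qc(1)])
  also have "transpose_mat (F * P * ?T) = transpose_mat ?T * transpose_mat (F * P)"
    by (rule transpose_mult[OF mult_carrier_mat[OF F Pc(1)] T])
  also have "\<dots> = F * (P * ?T)"
    unfolding transpose_mult[OF F Pc(1)] Pc(2) by simp
  finally have "transpose_mat (F * P * ?T + Q) = F * P * ?T + Q"
    using F Pc T Qc by simp
  moreover have "0 < v \<bullet> ((F * P * ?T + Q) *\<^sub>v v)" if v: "v \<in> carrier_vec e" "v \<noteq> 0\<^sub>v e" for v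
  proof -
    have Tv: "?T *\<^sub>v v \<in> carrier_vec d" using T v by simp
    have "v \<bullet> ((F * P * ?T) *\<^sub>v v) = v \<bullet> (F *\<^sub>v (P *\<^sub>v (?T *\<^sub>v v)))"
      using F Pc T v by (simp add: assoc_mult_mat_vec[of _ e d _ e] assoc_mult_mat_vec[of _ d d _ e])
    also have "\<dots> = (?T *\<^sub>v v) \<bullet> (P *\<^sub>v (?T *\<^sub>v v))"
      using transpose_vec_mult_scalar[of F e d "P *\<^sub>v (?T *\<^sub>v v)" v] F Pc Tv v
      by (metis mult_mat_vec_carrier)
    also have "\<dots> \<ge> 0"
      using P Tv Pc by (cases "?T *\<^sub>v v = 0\<^sub>v d") (auto simp: sym_pos_def_def less_imp_le)
    finally have "0 \<le> v \<bullet> ((F * P * ?T) *\<^sub>v v)" .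
    moreover have "0 < v \<bullet> (Q *\<^sub>v v)" using Q v by (simp add: sym_pos_def_def)
    moreover have "v \<bullet> ((F * P * ?T + Q) *\<^sub>v v) = v \<bullet> ((F * P * ?T) *\<^sub>v v) + v \<bullet> (Q *\<^sub>v v)"
      unfolding add_mult_distrib_mat_vec[OF A Qc(1) v(1)]
      using A Qc v mult_mat_vec_carrier by (intro scalar_prod_add_distrib) auto
    ultimately show ?thesis by simp
  qed
  ultimately show ?thesis using A Qc by (simp add: sym_pos_def_def)
qed

text \<open>The Chapman-Kolmogorov integral for one pair of modes, with the transition probability
  and the previous mode probability pulled out as a weight.\<close>

definition predicted_component ::
  "nat \<Rightarrow> real mat \<Rightarrow> real vec \<Rightarrow> real mat \<Rightarrow> real vec \<Rightarrow> real mat \<Rightarrow> real vec \<Rightarrow> real" where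
  "predicted_component d F b Q a P x =
     (\<integral>x'. gauss (F *\<^sub>v x' + b) Q x * gauss a P x' \<partial>lborel_vec d)"

text \<open>The moments follow once \<open>density ?E g\<close> is identified with the law of the
  independent sum. Both measures are compared on each measurable set, Tonelli moving the integral
  over the previous state outside.\<close>

lemma predicted_component:
  assumes P: "sym_pos_def d P" and Q: "sym_pos_def e Q" and F: "F \<in> carrier_mat e d"
    and b: "b \<in> carrier_vec e" and a: "a \<in> carrier_vec d"
  defines "g \<equiv> predicted_component d F b Q a P"
  shows predicted_component_nonneg: "\<And>x. 0 \<le> g x"
    and predicted_component_measurable: "g \<in> borel_measurable (lborel_vec e)"
    and predicted_component_moments:
      "has_moments (density (lborel_vec e) g) e (F *\<^sub>v a + b) (F * P * transpose_mat F + Q)"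
proof -
  let ?L = "lborel_vec d" and ?E = "lborel_vec e"
  let ?N = "gauss_measure (0\<^sub>v e) Q" and ?M = "gauss_measure a P"
  let ?j = "\<lambda>x x'. gauss (F *\<^sub>v x' + b) Q x * gauss a P x'"
  interpret L: sigma_finite_measure ?L by (rule sigma_finite_lborel_vec)
  interpret E: sigma_finite_measure ?E by (rule sigma_finite_lborel_vec)
  interpret LE: pair_sigma_finite ?L ?E ..
  show nn: "0 \<le> g x" for x
    unfolding g_def predicted_component_def
    using gauss_pos[OF P] gauss_pos[OF Q] by (intro integral_nonneg_AE AE_I2) (simp add: less_imp_le)
  have idL: "(\<lambda>x. x) \<in> measurable ?L ?L" and idE: "(\<lambda>x. x) \<in> measurable ?E ?E" by simp_all
  have F': "(\<lambda>p. F *\<^sub>v h p + b) \<in> measurable M ?E" if "h \<in> measurable M ?L" for h M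
    by (intro measurable_plus_vec measurable_mult_mat_vec[OF that F] measurable_const) (simp add: b)
  have Fc: "F *\<^sub>v x' + b \<in> carrier_vec e" if "x' \<in> carrier_vec d" for x' using F b that by simp
  have gP [measurable]: "gauss a P \<in> borel_measurable ?L"
    using borel_measurable_gauss[OF P _ idL, of "\<lambda>_. a"] a by simp
  have jm: "(\<lambda>p. ?j (snd p) (fst p)) \<in> borel_measurable (?L \<Otimes>\<^sub>M ?E)"
    by (intro borel_measurable_times borel_measurable_gauss[OF Q F'] measurable_fst measurable_snd
        measurable_compose[OF measurable_fst gP])
  have jm': "(\<lambda>p. ?j (fst p) (snd p)) \<in> borel_measurable (?E \<Otimes>\<^sub>M ?L)"
    by (intro borel_measurable_times borel_measurable_gauss[OF Q F'] measurable_fst measurable_snd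
        measurable_compose[OF measurable_snd gP])
  show gm [measurable]: "g \<in> borel_measurable ?E"
    unfolding g_def predicted_component_def
    using L.borel_measurable_lebesgue_integral[of ?j ?E] jm' by (simp add: case_prod_beta')
  have MM: "has_moments ?M d a P" by (rule has_moments_gauss[OF P a])
  have NM: "has_moments ?N e (0\<^sub>v e) Q" by (rule has_moments_gauss[OF Q]) simp
  have MM': "has_moments (distr ?M ?E (\<lambda>x'. F *\<^sub>v x' + b)) e (F *\<^sub>v a + b) (F * P * transpose_mat F)"
    by (rule has_moments_affine[OF MM F b])
  interpret N: prob_space ?N by (rule has_momentsD[OF NM])
  interpret D: prob_space "distr ?M ?E (\<lambda>x'. F *\<^sub>v x' + b)" by (rule has_momentsD[OF MM'])
  have intP: "integrable ?L (gauss a P)"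
  proof -
    interpret M: prob_space ?M by (rule has_momentsD[OF MM])
    have "integrable (density ?L (gauss a P)) (\<lambda>_. 1 :: real)"
      using M.integrable_const[of "1 :: real"] a by (simp add: gauss_measure_def)
    then show ?thesis
      using gauss_pos[OF P] by (subst (asm) integrable_density) (auto simp: less_imp_le)
  qed
  \<comment> \<open>A Bochner integral is zero when its integrand is not integrable, so
    integrability has to be proved at every \<open>x\<close> before passing to
    \<open>nn_integral\<close>. The bound \<open>gauss_le\<close> on the first factor and
    \<open>intP\<close> for the second give it.\<close>
  have gx: "ennreal (g x) = (\<integral>\<^sup>+x'. ennreal (?j x x') \<partial>?L)" if x: "x \<in> carrier_vec e" for x
  proof -
    have "integrable ?L (?j x)"
    proof (rule Bochner_Integration.integrable_bound)
      show "integrable ?L (\<lambda>x'. 1 / sqrt ((2 * pi) ^ e * Determinant.det Q) * gauss a P x')"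
        using intP by simp
      show "?j x \<in> borel_measurable ?L"
        using x by (intro borel_measurable_times gP borel_measurable_gauss[OF Q F'] measurable_const) auto
      show "AE x' in ?L. norm (?j x x') \<le> norm (1 / sqrt ((2 * pi) ^ e * Determinant.det Q) * gauss a P x')"
      proof (rule AE_I2)
        fix x' assume "x' \<in> space ?L"
        then have "gauss (F *\<^sub>v x' + b) Q x \<le> 1 / sqrt ((2 * pi) ^ e * Determinant.det Q)"
          using gauss_le[OF Q Fc x] by simp
        then show "norm (?j x x') \<le> norm (1 / sqrt ((2 * pi) ^ e * Determinant.det Q) * gauss a P x')"
          using gauss_pos[OF P, of a x'] gauss_pos[OF Q, of "F *\<^sub>v x' + b" x] det_sym_pos_def[OF Q]
          unfolding norm_mult by (intro mult_right_mono) auto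
      qed
    qed
    then show ?thesis
      unfolding g_def predicted_component_def
      using gauss_pos[OF P] gauss_pos[OF Q]
      by (intro nn_integral_eq_integral[symmetric]) (auto simp: less_imp_le)
  qed
  let ?S = "distr ?M ?E (\<lambda>x'. F *\<^sub>v x' + b) \<Otimes>\<^sub>M ?N"
  have sM: "sets ?M = sets ?L" and sN: "sets ?N = sets ?E"
    using has_momentsD[OF MM] has_momentsD[OF NM] by auto
  have sS: "sets ?S = sets (?E \<Otimes>\<^sub>M ?E)" by (rule sets_pair_measure_cong) (simp_all add: sN)
  have plus: "(\<lambda>p. fst p + snd p) \<in> measurable (?E \<Otimes>\<^sub>M ?E) ?E"
    by (intro measurable_plus_vec measurable_fst measurable_snd)
  have plusS: "(\<lambda>p. fst p + snd p) \<in> measurable ?S ?E"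
    using plus by (simp add: measurable_cong_sets[OF sS refl])
  have "density ?E g = distr ?S ?E (\<lambda>p. fst p + snd p)"
  proof (rule measure_eqI)
    fix A assume "A \<in> sets (density ?E g)"
    then have A [measurable]: "A \<in> sets ?E" by simp
    \<comment> \<open>\<open>?k x\<close> is the probability that \<open>x\<close> plus the noise
      lands in \<open>A\<close>.\<close>
    let ?k = "\<lambda>x. \<integral>\<^sup>+y. indicator A (x + y) \<partial>?N"
    have iA: "(\<lambda>p. indicator A (fst p + snd p) :: ennreal) \<in> borel_measurable ?S"
      by (rule measurable_compose[OF plusS]) simp
    have k: "?k \<in> borel_measurable ?E"
      using N.borel_measurable_nn_integral_fst[OF iA] by simp
    have "emeasure (density ?E g) A = (\<integral>\<^sup>+x. ennreal (g x) * indicator A x \<partial>?E)"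
      by (rule emeasure_density) measurable
    also have "\<dots> = (\<integral>\<^sup>+x. (\<integral>\<^sup>+x'. ennreal (?j x x') * indicator A x \<partial>?L) \<partial>?E)"
    proof (rule nn_integral_cong)
      fix x assume x: "x \<in> space ?E"
      have "(\<lambda>x'. ennreal (?j x x')) \<in> borel_measurable ?L"
        using x by (intro measurable_compose[OF _ measurable_ennreal] borel_measurable_times gP
            borel_measurable_gauss[OF Q F'] measurable_const) auto
      then show "ennreal (g x) * indicator A x = (\<integral>\<^sup>+x'. ennreal (?j x x') * indicator A x \<partial>?L)"
        using x by (simp add: gx nn_integral_multc)
    qed
    also have "\<dots> = (\<integral>\<^sup>+x'. (\<integral>\<^sup>+x. ennreal (?j x x') * indicator A x \<partial>?E) \<partial>?L)"
    proof (rule LE.Fubini')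
      have "(\<lambda>p. ennreal (?j (snd p) (fst p)) * indicator A (snd p)) \<in> borel_measurable (?L \<Otimes>\<^sub>M ?E)"
        using jm by measurable
      then show "(\<lambda>(x', x). ennreal (?j x x') * indicator A x) \<in> borel_measurable (?L \<Otimes>\<^sub>M ?E)"
        by (simp add: case_prod_beta')
    qed
    \<comment> \<open>At fixed \<open>x'\<close> the integral over \<open>x\<close> is the mass of
      \<open>A\<close> under the Gaussian centred at \<open>F *\<^sub>v x' + b\<close>, which is
      centred noise shifted by that point.\<close>
    also have "\<dots> = (\<integral>\<^sup>+x'. ennreal (gauss a P x') * (\<integral>\<^sup>+y. indicator A (F *\<^sub>v x' + b + y) \<partial>?N) \<partial>?L)"
    proof (rule nn_integral_cong)
      fix x' assume "x' \<in> space ?L"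
      then have c: "F *\<^sub>v x' + b \<in> carrier_vec e" using Fc by simp
      let ?c = "F *\<^sub>v x' + b"
      have [measurable]: "gauss ?c Q \<in> borel_measurable ?E"
        using borel_measurable_gauss[OF Q _ idE, of "\<lambda>_. ?c"] c by simp
      have cy: "(\<lambda>y. ?c + y) \<in> measurable ?N ?E"
        using c by (intro measurable_plus_vec measurable_const measurable_id_cong[OF sN]) simp
      have "(\<integral>\<^sup>+x. ennreal (?j x x') * indicator A x \<partial>?E) =
        (\<integral>\<^sup>+x. ennreal (gauss a P x') * (ennreal (gauss ?c Q x) * indicator A x) \<partial>?E)"
        using gauss_pos[OF P, of a x'] gauss_pos[OF Q, of ?c]
        by (intro nn_integral_cong) (simp add: ennreal_mult less_imp_le ac_simps)
      also have "\<dots> = ennreal (gauss a P x') * (\<integral>\<^sup>+x. ennreal (gauss ?c Q x) * indicator A x \<partial>?E)"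
        by (rule nn_integral_cmult) measurable
      also have "(\<integral>\<^sup>+x. ennreal (gauss ?c Q x) * indicator A x \<partial>?E) = emeasure (gauss_measure ?c Q) A"
        using c F b by (simp add: gauss_measure_def emeasure_density)
      also have "\<dots> = (\<integral>\<^sup>+x. indicator A x \<partial>distr ?N ?E (\<lambda>y. ?c + y))"
        unfolding gauss_measure_shift[OF Q c] by simp
      also have "\<dots> = (\<integral>\<^sup>+y. indicator A (?c + y) \<partial>?N)"
        by (rule nn_integral_distr[OF cy]) simp
      finally show "(\<integral>\<^sup>+x. ennreal (?j x x') * indicator A x \<partial>?E) =
        ennreal (gauss a P x') * (\<integral>\<^sup>+y. indicator A (?c + y) \<partial>?N)" .
    qed
    also have "\<dots> = (\<integral>\<^sup>+x'. ?k (F *\<^sub>v x' + b) \<partial>?M)"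
      using a measurable_compose[OF F'[OF idL] k]
      by (simp add: gauss_measure_def nn_integral_density)
    also have "\<dots> = (\<integral>\<^sup>+x. ?k x \<partial>distr ?M ?E (\<lambda>x'. F *\<^sub>v x' + b))"
      using k by (intro nn_integral_distr[symmetric] F' measurable_id_cong[OF sM]) simp
    also have "\<dots> = (\<integral>\<^sup>+p. indicator A (fst p + snd p) \<partial>?S)"
      using N.nn_integral_fst[OF iA] by simp
    also have "\<dots> = (\<integral>\<^sup>+x. indicator A x \<partial>distr ?S ?E (\<lambda>p. fst p + snd p))"
      by (rule nn_integral_distr[OF plusS, symmetric]) simp
    finally show "emeasure (density ?E g) A = emeasure (distr ?S ?E (\<lambda>p. fst p + snd p)) A" by simp
  qed simp
  moreover have "has_moments (distr ?S ?E (\<lambda>p. fst p + snd p)) e (F *\<^sub>v a + b + 0\<^sub>v e)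
    (F * P * transpose_mat F + Q)"
    by (rule has_moments_indep_sum[OF MM' NM])
  ultimately show "has_moments (density ?E g) e (F *\<^sub>v a + b) (F * P * transpose_mat F + Q)"
    using F b a by simp
qed

section \<open>Mixtures and the divergence\<close>

lemma prob_spaceI_has_bochner_integral:
  assumes "has_bochner_integral M (\<lambda>_. 1 :: real) 1"
  shows "prob_space M"
  using assms
  by (intro prob_spaceI) (auto simp: has_bochner_integral_iff integrable_iff_bounded
      emeasure_eq_ennreal_measure)

lemma has_bochner_integral_density_iff:
  fixes f g :: "'a \<Rightarrow> real"
  assumes "f \<in> borel_measurable M" "g \<in> borel_measurable M" "\<And>x. x \<in> space M \<Longrightarrow> 0 \<le> g x"
  shows "has_bochner_integral (density M g) f v \<longleftrightarrow> has_bochner_integral M (\<lambda>x. g x * f x) v"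
  using assms by (simp add: has_bochner_integral_iff integrable_density integral_density)

lemma has_bochner_integral_mixture:
  fixes f :: "'a \<Rightarrow> real" and g :: "'k \<Rightarrow> 'a \<Rightarrow> real" and \<alpha> v :: "'k \<Rightarrow> real"
  assumes f: "f \<in> borel_measurable L"
    and g: "\<And>k. k \<in> I \<Longrightarrow> g k \<in> borel_measurable L" "\<And>k x. k \<in> I \<Longrightarrow> 0 \<le> g k x"
    and \<alpha>: "\<And>k. k \<in> I \<Longrightarrow> 0 \<le> \<alpha> k"
    and v: "\<And>k. k \<in> I \<Longrightarrow> has_bochner_integral (density L (g k)) f (v k)"
  shows "has_bochner_integral (density L (\<lambda>x. \<Sum>k\<in>I. \<alpha> k * g k x)) f (\<Sum>k\<in>I. \<alpha> k * v k)"
proof -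
  have "has_bochner_integral L (\<lambda>x. \<Sum>k\<in>I. \<alpha> k * (g k x * f x)) (\<Sum>k\<in>I. \<alpha> k * v k)"
    using v by (intro has_bochner_integral_sum has_bochner_integral_mult_right)
      (simp add: has_bochner_integral_density_iff f g)
  then show ?thesis
    using g \<alpha> by (subst has_bochner_integral_density_iff)
      (auto simp: f sum_distrib_right mult.assoc intro!: sum_nonneg borel_measurable_sum borel_measurable_times)
qed

text \<open>This is the law of total covariance. Uncentred moments are averaged with the weights;
  since the weights sum to one, the averaged products of the component means minus
  \<open>c c^T\<close> are the weighted spread of those means about \<open>c\<close>.\<close>

lemma has_moments_mixture:
  fixes g :: "'k \<Rightarrow> real vec \<Rightarrow> real" and \<alpha> :: "'k \<Rightarrow> real"
  assumes \<alpha>: "\<And>k. k \<in> I \<Longrightarrow> 0 \<le> \<alpha> k" "(\<Sum>k\<in>I. \<alpha> k) = 1"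
    and g: "\<And>k. k \<in> I \<Longrightarrow> g k \<in> borel_measurable (lborel_vec d)" "\<And>k x. k \<in> I \<Longrightarrow> 0 \<le> g k x"
    and mom: "\<And>k. k \<in> I \<Longrightarrow> has_moments (density (lborel_vec d) (g k)) d (a k) (S k)"
  defines "c \<equiv> lincomb_vec d \<alpha> a I"
  shows "has_moments (density (lborel_vec d) (\<lambda>x. \<Sum>k\<in>I. \<alpha> k * g k x)) d c
    (lincomb_mat d \<alpha> (\<lambda>k. outer_square (a k - c)) I + lincomb_mat d \<alpha> S I)"
proof -
  let ?D = "density (lborel_vec d) (\<lambda>x. \<Sum>k\<in>I. \<alpha> k * g k x)"
  let ?C = "lincomb_mat d \<alpha> (\<lambda>k. outer_square (a k - c)) I + lincomb_mat d \<alpha> S I"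
  note MD = has_momentsD[OF mom]
  have vm [measurable]: "(\<lambda>x. x $ i) \<in> borel_measurable (lborel_vec d)" if "i < d" for i
    by (rule measurable_vec_index[OF _ that]) simp
  note mix = has_bochner_integral_mixture[where \<alpha>=\<alpha> and g=g and I=I and L="lborel_vec d", OF _ g \<alpha>(1)]
  have c: "c $ i = (\<Sum>k\<in>I. \<alpha> k * a k $ i)" if "i < d" for i
    using that by (simp add: c_def lincomb_vec_def)
  have cc: "c \<in> carrier_vec d" by (simp add: c_def lincomb_vec_def)
  have "has_bochner_integral ?D (\<lambda>_. 1) (\<Sum>k\<in>I. \<alpha> k * 1)"
    by (intro mix prob_space.has_bochner_integral_const_prob MD) auto
  then have "prob_space ?D" using \<alpha>(2) by (intro prob_spaceI_has_bochner_integral) simp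
  moreover have "has_bochner_integral ?D (\<lambda>x. x $ i) (c $ i)" if i: "i < d" for i
    unfolding c[OF i] by (intro mix MD vm i)
  moreover have "has_bochner_integral ?D (\<lambda>x. x $ i * x $ j) (?C $$ (i, j) + c $ i * c $ j)"
    if i: "i < d" and j: "j < d" for i j
  proof -
    have "has_bochner_integral ?D (\<lambda>x. x $ i * x $ j)
      (\<Sum>k\<in>I. \<alpha> k * (S k $$ (i, j) + a k $ i * a k $ j))"
      by (intro mix MD borel_measurable_times vm i j)
    moreover have "?C $$ (i, j) = (\<Sum>k\<in>I. \<alpha> k * ((a k $ i - c $ i) * (a k $ j - c $ j))) +
      (\<Sum>k\<in>I. \<alpha> k * S k $$ (i, j))"
    proof -
      have "outer_square (a k - c) $$ (i, j) = (a k $ i - c $ i) * (a k $ j - c $ j)" if "k \<in> I" for k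
        using MD(4)[OF that] cc i j by (simp add: outer_square_def)
      then show ?thesis using i j by (simp add: lincomb_mat_def)
    qed
    moreover have "(\<Sum>k\<in>I. \<alpha> k * ((a k $ i - c $ i) * (a k $ j - c $ j))) =
      (\<Sum>k\<in>I. \<alpha> k * (a k $ i * a k $ j)) - c $ i * c $ j"
    proof -
      have "(\<Sum>k\<in>I. \<alpha> k * ((a k $ i - c $ i) * (a k $ j - c $ j))) =
        (\<Sum>k\<in>I. \<alpha> k * (a k $ i * a k $ j) - c $ j * (\<alpha> k * a k $ i) - c $ i * (\<alpha> k * a k $ j) +
          c $ i * c $ j * \<alpha> k)"
        by (intro sum.cong refl) (simp add: algebra_simps)
      also have "\<dots> = (\<Sum>k\<in>I. \<alpha> k * (a k $ i * a k $ j)) - c $ j * c $ i - c $ i * c $ j + c $ i * c $ j * 1"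
        by (simp only: sum.distrib sum_subtractf sum_distrib_left[symmetric] \<alpha>(2) c[OF i, symmetric]
            c[OF j, symmetric])
      finally show ?thesis by simp
    qed
    ultimately show ?thesis by (simp add: distrib_left sum.distrib add.commute)
  qed
  moreover have "?C \<in> carrier_mat d d" by (simp add: lincomb_mat_def)
  ultimately show ?thesis using cc by (simp add: has_moments_def)
qed

text \<open>The outer squares contribute squares, which are nonnegative. Strictness comes from a
  single index of positive weight, which exists because the weights sum to one.\<close>

lemma sym_pos_def_mixture_cov:
  assumes fin: "finite I" and \<alpha>: "\<And>k. k \<in> I \<Longrightarrow> 0 \<le> \<alpha> k" "(\<Sum>k\<in>I. \<alpha> k) = 1"
    and S: "\<And>k. k \<in> I \<Longrightarrow> sym_pos_def d (S k)"
    and u: "\<And>k. k \<in> I \<Longrightarrow> u k \<in> carrier_vec d"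
  shows "sym_pos_def d (lincomb_mat d \<alpha> (\<lambda>k. outer_square (u k)) I + lincomb_mat d \<alpha> S I)"
  unfolding sym_pos_def_iff
proof (intro conjI allI impI)
  let ?C = "lincomb_mat d \<alpha> (\<lambda>k. outer_square (u k)) I + lincomb_mat d \<alpha> S I"
  show "?C \<in> carrier_mat d d" by (simp add: lincomb_mat_def)
  have C: "?C $$ (i, j) = (\<Sum>k\<in>I. \<alpha> k * (u k $ i * u k $ j + S k $$ (i, j)))"
    if "i < d" "j < d" for i j
  proof -
    have "outer_square (u k) $$ (i, j) = u k $ i * u k $ j" if "k \<in> I" for k
      using u[OF that] \<open>i < d\<close> \<open>j < d\<close> by (simp add: outer_square_def)
    then show ?thesis using that by (simp add: lincomb_mat_def distrib_left sum.distrib)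
  qed
  note SD = S[unfolded sym_pos_def_iff]
  show "?C $$ (i, j) = ?C $$ (j, i)" if "i < d" "j < d" for i j
    using SD that by (simp add: C mult.commute)
  fix v :: "nat \<Rightarrow> real" assume v: "\<exists>i<d. v i \<noteq> 0"
  have "(\<Sum>i<d. \<Sum>j<d. v i * ?C $$ (i, j) * v j) =
    (\<Sum>i<d. \<Sum>j<d. \<Sum>k\<in>I. \<alpha> k * ((v i * u k $ i) * (v j * u k $ j) + v i * S k $$ (i, j) * v j))"
    by (intro sum.cong refl) (simp add: C sum_distrib_left sum_distrib_right algebra_simps)
  also have "\<dots> = (\<Sum>k\<in>I. \<Sum>i<d. \<Sum>j<d. \<alpha> k * ((v i * u k $ i) * (v j * u k $ j) + v i * S k $$ (i, j) * v j))"
    by (simp only: sum.swap[where A="{..<d}" and B=I])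
  also have "\<dots> = (\<Sum>k\<in>I. \<alpha> k * ((\<Sum>i<d. v i * u k $ i)\<^sup>2 + (\<Sum>i<d. \<Sum>j<d. v i * S k $$ (i, j) * v j)))"
    unfolding power2_eq_square sum_product sum.distrib[symmetric] by (simp only: sum_distrib_left)
  also have "\<dots> > 0"
  proof -
    have q: "0 < (\<Sum>i<d. v i * u k $ i)\<^sup>2 + (\<Sum>i<d. \<Sum>j<d. v i * S k $$ (i, j) * v j)" if "k \<in> I" for k
      using SD[OF that] v by (intro add_nonneg_pos) auto
    obtain k where k: "k \<in> I" "\<alpha> k \<noteq> 0" using \<alpha>(2) sum.neutral[of I \<alpha>] by fastforce
    show ?thesis
    proof (rule sum_pos2[OF fin k(1)])
      show "0 < \<alpha> k * ((\<Sum>i<d. v i * u k $ i)\<^sup>2 + (\<Sum>i<d. \<Sum>j<d. v i * S k $$ (i, j) * v j))"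
        using q[OF k(1)] \<alpha>(1)[OF k(1)] k(2) by (intro mult_pos_pos) auto
    qed (use q \<alpha>(1) in \<open>auto intro!: mult_nonneg_nonneg simp: less_imp_le\<close>)
  qed
  finally show "0 < (\<Sum>i<d. \<Sum>j<d. v i * ?C $$ (i, j) * v j)" .
qed

lemma borel_measurable_gauss_lborel:
  assumes "sym_pos_def d P" "a \<in> carrier_vec d"
  shows "gauss a P \<in> borel_measurable (lborel_vec d)"
  by (rule borel_measurable_gauss[OF assms(1), of "\<lambda>_. a"]) (simp_all add: assms(2))

lemma has_bochner_integral_gauss:
  assumes P: "sym_pos_def d P" and a: "a \<in> carrier_vec d"
  shows "has_bochner_integral (lborel_vec d) (gauss a P) 1"
proof -
  have "prob_space (density (lborel_vec d) (gauss a P))"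
    using has_momentsD(1)[OF has_moments_gauss[OF P a]] a by (simp add: gauss_measure_def)
  from prob_space.has_bochner_integral_const_prob[OF this, of 1]
  show ?thesis
    using gauss_pos[OF P] borel_measurable_gauss_lborel[OF P a]
    by (subst (asm) has_bochner_integral_density_iff) (auto simp: less_imp_le)
qed

lemma nn_integral_has_bochner_integral:
  assumes "has_bochner_integral M f (v :: real)" "\<And>x. x \<in> space M \<Longrightarrow> 0 \<le> f x"
  shows "(\<integral>\<^sup>+x. ennreal (f x) \<partial>M) = ennreal v"
  using assms by (subst nn_integral_eq_integral) (auto simp: has_bochner_integral_iff)

text \<open>The constant \<open>D\<close> is obtained before the measure \<open>M\<close> is chosen.
  This order of quantifiers is what lets an expectation under the predicted density be replaced by
  one under the Gaussian with the same moments.\<close>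

lemma ln_gauss_expectation_from_moments:
  assumes R: "sym_pos_def d R" and s: "s \<in> carrier_vec d"
  obtains D where "\<And>M. has_moments M d c C \<Longrightarrow> has_bochner_integral M (\<lambda>x. ln (gauss s R x)) D"
proof -
  let ?K = "the (mat_inverse R)"
  let ?z = "ln (sqrt ((2 * pi) ^ d * Determinant.det R))"
  let ?q = "\<Sum>i<d. \<Sum>j<d. ?K $$ (i, j) * (C $$ (i, j) + (c $ i - s $ i) * (c $ j - s $ j))"
  have K: "?K \<in> carrier_mat d d"
    using the_mat_inverse[of R d] det_sym_pos_def[OF R] R by (auto simp: sym_pos_def_def)
  have "ln (gauss s R x) = (- 1 / 2) * ((x - s) \<bullet> (?K *\<^sub>v (x - s))) + (- ?z)" for x
    using det_sym_pos_def[OF R] s by (simp add: gauss_def ln_div)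
  moreover have "has_bochner_integral M
    (\<lambda>x. (- 1 / 2) * ((x - s) \<bullet> (?K *\<^sub>v (x - s))) + (- ?z)) ((- 1 / 2) * ?q + (- ?z))"
    if M: "has_moments M d c C" for M
    by (intro has_bochner_integral_add has_bochner_integral_mult_right
        has_bochner_integral_quadratic[OF M K s]
        prob_space.has_bochner_integral_const_prob has_momentsD(1)[OF M])
  ultimately show ?thesis by (intro that[of "(- 1 / 2) * ?q + (- ?z)"]) simp
qed

text \<open>The inequality \<open>ln t \<le> t - 1\<close> at \<open>t = q / p\<close>. It is Gibbs'
  inequality before integration and makes no assumption on the total masses.\<close>

lemma diff_le_mult_ln_div:
  assumes "0 \<le> p" "0 < (q :: real)"
  shows "p - q \<le> p * ln (p / q)"
proof (cases "p = 0")
  case False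
  then have p: "0 < p" using assms by simp
  have "ln (q / p) \<le> q / p - 1" using p assms by (intro ln_le_minus_one) simp
  then have "p * ln (q / p) \<le> q - p" using p by (simp add: field_simps)
  then show ?thesis using p assms by (simp add: ln_div algebra_simps)
qed (use assms in simp)

lemma ereal_integral_cong:
  assumes "\<And>x. x \<in> space M \<Longrightarrow> h x = h' x"
  shows "ereal_integral M h = ereal_integral M h'"
  unfolding ereal_integral_def
  by (intro arg_cong2[where f = minus] arg_cong[where f = enn2ereal] nn_integral_cong) (simp_all add: assms)

lemma ereal_integral_eq_integral:
  assumes "integrable M k"
  shows "ereal_integral M (\<lambda>x. ereal (k x)) = ereal (\<integral>x. k x \<partial>M)"
proof -
  have e: "e2ennreal (ereal y) = ennreal y" for y by (simp add: ennreal.abs_eq)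
  have "(\<integral>\<^sup>+x. ennreal (k x) \<partial>M) \<noteq> \<top>" "(\<integral>\<^sup>+x. ennreal (- k x) \<partial>M) \<noteq> \<top>"
    using assms by (auto simp: real_integrable_def)
  then have "enn2ereal (\<integral>\<^sup>+x. ennreal (k x) \<partial>M) = ereal (enn2real (\<integral>\<^sup>+x. ennreal (k x) \<partial>M))"
    "enn2ereal (\<integral>\<^sup>+x. ennreal (- k x) \<partial>M) = ereal (enn2real (\<integral>\<^sup>+x. ennreal (- k x) \<partial>M))"
    by (metis enn2ereal_ennreal enn2real_nonneg ennreal_enn2real less_top)+
  then show ?thesis
    unfolding ereal_integral_def by (simp add: e real_lebesgue_integral_def[OF assms])
qed

text \<open>By the pointwise Gibbs inequality the negative part of the integrand is at most
  \<open>q\<close>, which is integrable. Only the positive part can have an infinite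
  integral.\<close>

lemma ereal_integral_kl_dichotomy:
  assumes p: "p \<in> borel_measurable M" "\<And>x. x \<in> space M \<Longrightarrow> 0 \<le> p x"
    and q: "integrable M q" "\<And>x. x \<in> space M \<Longrightarrow> 0 < q x"
  shows "ereal_integral M (\<lambda>x. kl_integrand (p x) (q x)) = \<infinity> \<or>
    integrable M (\<lambda>x. p x * ln (p x / q x))"
proof -
  note [measurable] = p(1) borel_measurable_integrable[OF q(1)]
  let ?k = "\<lambda>x. p x * ln (p x / q x)"
  have e: "e2ennreal (ereal y) = ennreal y" for y by (simp add: ennreal.abs_eq)
  have k: "kl_integrand (p x) (q x) = ereal (?k x)" if "x \<in> space M" for x
    using q(2)[OF that] by (simp add: kl_integrand_def)
  have "(\<integral>\<^sup>+x. ennreal (- ?k x) \<partial>M) \<le> (\<integral>\<^sup>+x. ennreal (q x) \<partial>M)"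
  proof (intro nn_integral_mono ennreal_leI)
    show "- ?k x \<le> q x" if "x \<in> space M" for x
      using diff_le_mult_ln_div[OF p(2)[OF that] q(2)[OF that]] p(2)[OF that] by linarith
  qed
  also have "\<dots> < \<top>" using q(1) by (simp add: real_integrable_def less_top)
  finally have neg: "(\<integral>\<^sup>+x. ennreal (- ?k x) \<partial>M) \<noteq> \<top>" by simp
  show ?thesis
  proof (cases "(\<integral>\<^sup>+x. ennreal (?k x) \<partial>M) = \<top>")
    case True
    then have "(\<integral>\<^sup>+x. e2ennreal (kl_integrand (p x) (q x)) \<partial>M) = \<top>"
      by (subst nn_integral_cong[where v="\<lambda>x. ennreal (?k x)"]) (simp_all add: k e)
    then show ?thesis by (simp add: ereal_integral_def)
  next
    case False
    then show ?thesis using neg by (simp add: real_integrable_def)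
  qed
qed

text \<open>The term \<open>w - v\<close> is a lower bound for the divergence between the total masses; it cancels
  when summed over the modes.\<close>

lemma ereal_integral_kl_gauss_le:
  assumes p: "p \<in> borel_measurable (lborel_vec d)" "\<And>x. 0 \<le> p x"
    and mom: "has_moments (density (lborel_vec d) p) d c C"
    and C: "sym_pos_def d C" and R: "sym_pos_def d R" and s: "s \<in> carrier_vec d"
    and w: "0 < w" and v: "0 \<le> v"
  shows "ereal_integral (lborel_vec d) (\<lambda>x. kl_integrand (w * p x) (w * gauss c C x)) + ereal (w - v)
    \<le> ereal_integral (lborel_vec d) (\<lambda>x. kl_integrand (w * p x) (v * gauss s R x))"
proof (cases "v = 0")
  case True
  have p1: "has_bochner_integral (lborel_vec d) p 1"
    using prob_space.has_bochner_integral_const_prob[OF has_momentsD(1)[OF mom], of 1] p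
    by (simp add: has_bochner_integral_density_iff)
  \<comment> \<open>The competitor excludes a mode that has positive probability: the integrand is
    infinite wherever \<open>p\<close> is positive, and \<open>p\<close> has mass one.\<close>
  have "(\<lambda>x. e2ennreal (kl_integrand (w * p x) (v * gauss s R x))) = (\<lambda>x. \<top> * ennreal (p x))"
    using True w p(2) by (auto simp: kl_integrand_def ennreal_top_mult)
  moreover have "(\<integral>\<^sup>+x. \<top> * ennreal (p x) \<partial>lborel_vec d) = \<top> * (\<integral>\<^sup>+x. ennreal (p x) \<partial>lborel_vec d)"
    using p(1) by (intro nn_integral_cmult) simp
  ultimately have "(\<integral>\<^sup>+x. e2ennreal (kl_integrand (w * p x) (v * gauss s R x)) \<partial>lborel_vec d) = \<top>"
    using p(2) by (simp only: nn_integral_has_bochner_integral[OF p1]) (simp add: ennreal_top_mult)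
  then show ?thesis by (simp add: ereal_integral_def)
next
  case False
  then have v: "0 < v" using v by simp
  let ?L = "lborel_vec d"
  note cc = has_momentsD(4)[OF mom]
  note gi = has_bochner_integral_gauss[OF C cc] has_bochner_integral_gauss[OF R s]
  note gp = gauss_pos[OF C, of c] gauss_pos[OF R, of s]
  note gm [measurable] = borel_measurable_gauss_lborel[OF C cc] borel_measurable_gauss_lborel[OF R s]
  note [measurable] = p(1)
  let ?\<Delta> = "\<lambda>x. ln (w * gauss c C x) - ln (v * gauss s R x)"
  \<comment> \<open>\<open>D1\<close> and \<open>D2\<close> serve all measures with moments
    \<open>c\<close> and \<open>C\<close>. Hence \<open>D\<close> is the expectation of
    \<open>?\<Delta>\<close> both under the density \<open>p\<close> and under
    \<open>gauss c C\<close>.\<close>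
  obtain D1 where D1: "\<And>M. has_moments M d c C \<Longrightarrow> has_bochner_integral M (\<lambda>x. ln (gauss c C x)) D1"
    by (rule ln_gauss_expectation_from_moments[OF C cc, of c C]) blast
  obtain D2 where D2: "\<And>M. has_moments M d c C \<Longrightarrow> has_bochner_integral M (\<lambda>x. ln (gauss s R x)) D2"
    by (rule ln_gauss_expectation_from_moments[OF R s, of c C]) blast
  define D where "D = (ln w - ln v) + (D1 - D2)"
  have \<Delta>: "?\<Delta> x = (ln w - ln v) + (ln (gauss c C x) - ln (gauss s R x))" for x
    using gp[of x] w v by (simp add: ln_mult)
  have D: "has_bochner_integral M ?\<Delta> D" if M: "has_moments M d c C" for M
    unfolding \<Delta> D_def
    by (intro has_bochner_integral_add has_bochner_integral_diff D1 D2 M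
        prob_space.has_bochner_integral_const_prob has_momentsD(1)[OF M])
  have pD: "has_bochner_integral ?L (\<lambda>x. p x * ?\<Delta> x) D"
    using D[OF mom] p(2) by (subst (asm) has_bochner_integral_density_iff) auto
  have gD: "has_bochner_integral ?L (\<lambda>x. gauss c C x * ?\<Delta> x) D"
    using D[OF has_moments_gauss[OF C cc]] cc gp(1) unfolding gauss_measure_def
    by (subst (asm) has_bochner_integral_density_iff) (auto simp: less_imp_le)
  \<comment> \<open>Read as an expectation under \<open>gauss c C\<close>, the number
    \<open>w * D\<close> is a divergence between the two weighted Gaussians, and the pointwise
    inequality integrates to the difference of their masses.\<close>
  have wD: "w - v \<le> w * D"
  proof -
    have "has_bochner_integral ?L (\<lambda>x. w * gauss c C x - v * gauss s R x) (w * 1 - v * 1)"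
      by (intro has_bochner_integral_diff has_bochner_integral_mult_right gi)
    moreover have "has_bochner_integral ?L (\<lambda>x. w * (gauss c C x * ?\<Delta> x)) (w * D)"
      by (intro has_bochner_integral_mult_right gD)
    moreover have "w * gauss c C x - v * gauss s R x \<le> w * (gauss c C x * ?\<Delta> x)" for x
      using diff_le_mult_ln_div[of "w * gauss c C x" "v * gauss s R x"] gp[of x] w v
      by (simp add: ln_div mult.assoc less_imp_le)
    ultimately show ?thesis
      using integral_mono[of ?L "\<lambda>x. w * gauss c C x - v * gauss s R x" "\<lambda>x. w * (gauss c C x * ?\<Delta> x)"]
      by (simp only: has_bochner_integral_iff) simp
  qed
  let ?k = "\<lambda>x. w * p x * ln (w * p x / (v * gauss s R x))"
  let ?k' = "\<lambda>x. w * p x * ln (w * p x / (w * gauss c C x))"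
  have kl: "kl_integrand (w * p x) (v * gauss s R x) = ereal (?k x)"
    "kl_integrand (w * p x) (w * gauss c C x) = ereal (?k' x)" for x
    using gp[of x] w v by (auto simp: kl_integrand_def)
  \<comment> \<open>If \<open>?k\<close> is integrable, then so is \<open>?k'\<close>, which differs
    from it by a multiple of \<open>p x * ?\<Delta> x\<close>. If not, the right-hand side is
    infinite. Finiteness of the left-hand divergence is thus never assumed.\<close>
  show ?thesis
  proof (cases "integrable ?L ?k")
    case True
    have k': "?k' x = ?k x - w * (p x * ?\<Delta> x)" for x
    proof (cases "p x = 0")
      case False
      then have "0 < p x" using p(2)[of x] by simp
      then show ?thesis using gp[of x] w v by (simp add: ln_div ln_mult algebra_simps)
    qed simp
    have "has_bochner_integral ?L ?k' (integral\<^sup>L ?L ?k - w * D)"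
      unfolding k' using True pD
      by (intro has_bochner_integral_diff has_bochner_integral_mult_right) (auto simp: has_bochner_integral_iff)
    then have "integrable ?L ?k'" "integral\<^sup>L ?L ?k' = integral\<^sup>L ?L ?k - w * D"
      by (auto simp: has_bochner_integral_iff)
    then show ?thesis
      using True wD unfolding kl by (simp add: ereal_integral_eq_integral)
  next
    case False
    have "ereal_integral ?L (\<lambda>x. kl_integrand (w * p x) (v * gauss s R x)) = \<infinity>"
      using ereal_integral_kl_dichotomy[of "\<lambda>x. w * p x" ?L "\<lambda>x. v * gauss s R x"] False gi gp w v p(2)
      by (auto simp: has_bochner_integral_iff less_imp_le)
    then show ?thesis by simp
  qed
qed

section \<open>The optimal mode-wise Gaussian density\<close>

text \<open>Provides an admissible dummy covariance for modes of probability zero.\<close>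

lemma sym_pos_def_one: "sym_pos_def d (1\<^sub>m d)"
proof -
  have "0 < v \<bullet> v" if "v \<in> carrier_vec d" "v \<noteq> 0\<^sub>v d" for v :: "real vec"
  proof -
    have "\<exists>i<d. v $ i \<noteq> 0" using that by (auto simp: vec_eq_iff)
    then obtain i where "i < d" "v $ i \<noteq> 0" by blast
    then have "0 < (\<Sum>i\<in>{0..<d}. v $ i * v $ i)"
      by (intro sum_pos2[of _ i]) (auto simp: zero_less_mult_iff)
    then show ?thesis using that by (simp add: scalar_prod_def)
  qed
  then show ?thesis by (auto simp: sym_pos_def_def)
qed

lemma mode_marginal_nonneg:
  assumes "density_on m n f" "r \<in> {1..m}"
  shows "0 \<le> mode_marginal n f r"
  using assms unfolding mode_marginal_def density_on_def
  by (intro integral_nonneg_AE AE_I2) auto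

text \<open>\<open>density_on\<close> normalises \<open>nn_integral\<close>s, whereas
  \<open>mode_marginal\<close> is a Bochner integral. The Gaussian factor form supplies the
  integrability that makes them agree.\<close>

lemma mode_marginal_sum_eq_1:
  assumes f: "density_on m n f" "gaussian_given_mode m n a P f"
  shows "(\<Sum>r=1..m. mode_marginal n f r) = 1"
proof -
  have "(\<integral>\<^sup>+x. ennreal (f r x) \<partial>lborel_vec (n r)) = ennreal (mode_marginal n f r)"
    if r: "r \<in> {1..m}" for r
  proof -
    have g: "sym_pos_def (n r) (P r)" "a r \<in> carrier_vec (n r)"
      and fr: "\<forall>x\<in>carrier_vec (n r). f r x = mode_marginal n f r * gauss (a r) (P r) x"
      using f(2) r by (auto simp: gaussian_given_mode_def)
    have "has_bochner_integral (lborel_vec (n r)) (\<lambda>x. mode_marginal n f r * gauss (a r) (P r) x)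
        (mode_marginal n f r * 1)"
      by (intro has_bochner_integral_mult_right has_bochner_integral_gauss g)
    then have "has_bochner_integral (lborel_vec (n r)) (f r) (mode_marginal n f r)"
      by (rule iffD1[OF has_bochner_integral_cong, rotated -1]) (use fr in auto)
    then show ?thesis
      by (rule nn_integral_has_bochner_integral) (use f(1) r in \<open>auto simp: density_on_def\<close>)
  qed
  then have "(\<Sum>r=1..m. ennreal (mode_marginal n f r)) = 1"
    using f(1) by (simp add: density_on_def)
  then have "ennreal (\<Sum>r=1..m. mode_marginal n f r) = 1"
    using mode_marginal_nonneg[OF f(1)] by (subst sum_ennreal[symmetric]) auto
  then show ?thesis by (simp add: ennreal_eq_1)
qed

text \<open>In a mode of predicted probability zero the weights \<open>alpha\<close> are quotients
  by zero, hence zero, and \<open>Ppred\<close> is the zero matrix; the leading factor still makes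
  \<open>qopt\<close> vanish there. Definiteness is therefore claimed only for modes of positive
  probability. \<open>is_arg_min\<close> also asserts that \<open>qopt\<close> belongs to the
  competing family.\<close>

theorem theorem3:
  fixes m :: nat and n :: "nat \<Rightarrow> nat"
    and mu :: "nat \<Rightarrow> nat \<Rightarrow> real"
    and F Q :: "nat \<Rightarrow> nat \<Rightarrow> real mat" and b :: "nat \<Rightarrow> nat \<Rightarrow> real vec"
    and f :: "nat \<Rightarrow> real vec \<Rightarrow> real"
    and xbar :: "nat \<Rightarrow> real vec" and P :: "nat \<Rightarrow> real mat"
    and tdens :: "nat \<Rightarrow> nat \<Rightarrow> real vec \<Rightarrow> real vec \<Rightarrow> real"
    and fpred qopt :: "nat \<Rightarrow> real vec \<Rightarrow> real"
    and alpha :: "nat \<Rightarrow> nat \<Rightarrow> real"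
    and xpred2 :: "nat \<Rightarrow> nat \<Rightarrow> real vec" and Ppred2 :: "nat \<Rightarrow> nat \<Rightarrow> real mat"
    and xpred :: "nat \<Rightarrow> real vec" and Ppred :: "nat \<Rightarrow> real mat"
  assumes m: "1 \<le> m" and n: "\<And>r. r \<in> {1..m} \<Longrightarrow> 1 \<le> n r"
    and mu: "\<And>r'. r' \<in> {1..m} \<Longrightarrow> is_pmf_on m (\<lambda>r. mu r r')"
    and F: "\<And>r r'. r \<in> {1..m} \<Longrightarrow> r' \<in> {1..m} \<Longrightarrow> F r r' \<in> carrier_mat (n r) (n r')"
    and b: "\<And>r r'. r \<in> {1..m} \<Longrightarrow> r' \<in> {1..m} \<Longrightarrow> b r r' \<in> carrier_vec (n r)"
    and Q: "\<And>r r'. r \<in> {1..m} \<Longrightarrow> r' \<in> {1..m} \<Longrightarrow> sym_pos_def (n r) (Q r r')"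
    and f: "density_on m n f" "gaussian_given_mode m n xbar P f"
    and tdens: "tdens = (\<lambda>r r' x x'. gauss (F r r' *\<^sub>v x' + b r r') (Q r r') x)"
    and fpred: "fpred = chapman_kolmogorov m n mu tdens f"
    and alpha: "alpha = (\<lambda>r r'. mu r r' * mode_marginal n f r' /
                  (\<Sum>s=1..m. mu r s * mode_marginal n f s))"
    and xpred2: "xpred2 = (\<lambda>r r'. F r r' *\<^sub>v xbar r' + b r r')"
    and Ppred2: "Ppred2 = (\<lambda>r r'. F r r' * P r' * transpose_mat (F r r') + Q r r')"
    and xpred: "xpred = (\<lambda>r. lincomb_vec (n r) (alpha r) (xpred2 r) {1..m})"
    and Ppred: "Ppred = (\<lambda>r.
                  lincomb_mat (n r) (alpha r) (\<lambda>r'. outer_square (xpred2 r r' - xpred r)) {1..m}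
                  + lincomb_mat (n r) (alpha r) (Ppred2 r) {1..m})"
    and qopt: "qopt = (\<lambda>r x. mode_marginal n fpred r * gauss (xpred r) (Ppred r) x)"
  shows "density_on m n fpred \<and>
    (\<forall>r\<in>{1..m}. mode_marginal n fpred r = (\<Sum>r'=1..m. mu r r' * mode_marginal n f r')) \<and>
    (\<forall>r\<in>{1..m}. mode_marginal n qopt r = mode_marginal n fpred r) \<and>
    (\<forall>r\<in>{1..m}. 0 < mode_marginal n fpred r \<longrightarrow> sym_pos_def (n r) (Ppred r)) \<and>
    is_arg_min (KL_hybrid m n fpred) (mode_gaussian_density m n) qopt"
proof -
  define M where "M = mode_marginal n f"
  define w where "w r = (\<Sum>r'=1..m. mu r r' * M r')" for r
  define g where "g r r' = predicted_component (n r') (F r r') (b r r') (Q r r') (xbar r') (P r')" for r r'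
  let ?L = "\<lambda>r. lborel_vec (n r)"
  have M0: "0 \<le> M r" if "r \<in> {1..m}" for r
    unfolding M_def by (rule mode_marginal_nonneg[OF f(1) that])
  have M1: "(\<Sum>r=1..m. M r) = 1"
    unfolding M_def by (rule mode_marginal_sum_eq_1[OF f])
  have mu0: "0 \<le> mu r r'" if "r \<in> {1..m}" "r' \<in> {1..m}" for r r'
    using mu[OF that(2)] that(1) by (simp add: is_pmf_on_def)
  have mu1: "(\<Sum>r=1..m. mu r r') = 1" if "r' \<in> {1..m}" for r'
    using mu[OF that] by (simp add: is_pmf_on_def)
  have w0: "0 \<le> w r" if "r \<in> {1..m}" for r
    unfolding w_def using that by (intro sum_nonneg mult_nonneg_nonneg mu0 M0)
  have w1: "(\<Sum>r=1..m. w r) = 1"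
  proof -
    have "(\<Sum>r=1..m. w r) = (\<Sum>r'=1..m. \<Sum>r=1..m. mu r r' * M r')"
      unfolding w_def by (rule sum.swap)
    also have "\<dots> = (\<Sum>r'=1..m. M r')"
      by (intro sum.cong refl) (simp only: sum_distrib_right[symmetric] mu1 mult_1)
    finally show ?thesis using M1 by simp
  qed
  have xP: "xbar r \<in> carrier_vec (n r)" "sym_pos_def (n r) (P r)"
    and fr: "\<And>x. x \<in> carrier_vec (n r) \<Longrightarrow> f r x = M r * gauss (xbar r) (P r) x"
    if "r \<in> {1..m}" for r
    using f(2) that by (auto simp: gaussian_given_mode_def M_def)
  have g: "\<And>x. 0 \<le> g r r' x" "g r r' \<in> borel_measurable (?L r)"
    "has_moments (density (?L r) (g r r')) (n r) (xpred2 r r') (Ppred2 r r')"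
    if "r \<in> {1..m}" "r' \<in> {1..m}" for r r'
    unfolding g_def xpred2 Ppred2
    using predicted_component[OF xP(2)[OF that(2)] Q[OF that] F[OF that] b[OF that] xP(1)[OF that(2)]]
    by auto
  have gint: "has_bochner_integral (?L r) (g r r') 1" if "r \<in> {1..m}" "r' \<in> {1..m}" for r r'
    using prob_space.has_bochner_integral_const_prob[OF has_momentsD(1)[OF g(3)[OF that]], of 1]
    by (simp add: has_bochner_integral_density_iff g[OF that])
  have fpred_eq: "fpred r x = (\<Sum>r'=1..m. mu r r' * M r' * g r r' x)" for r x
    unfolding fpred chapman_kolmogorov_def
  proof (intro sum.cong refl)
    fix r' assume r': "r' \<in> {1..m}"
    have "(\<integral>x'. mu r r' * tdens r r' x x' * f r' x' \<partial>?L r') =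
      (\<integral>x'. (mu r r' * M r') * (gauss (F r r' *\<^sub>v x' + b r r') (Q r r') x * gauss (xbar r') (P r') x') \<partial>?L r')"
      by (rule Bochner_Integration.integral_cong) (simp_all add: tdens fr[OF r'])
    also have "\<dots> = mu r r' * M r' * g r r' x"
      unfolding g_def predicted_component_def by (rule integral_mult_right_zero)
    finally show "(\<integral>x'. mu r r' * tdens r r' x x' * f r' x' \<partial>?L r') = mu r r' * M r' * g r r' x" .
  qed
  have fint: "has_bochner_integral (?L r) (fpred r) (w r)" if r: "r \<in> {1..m}" for r
  proof -
    have "has_bochner_integral (?L r) (\<lambda>x. \<Sum>r'=1..m. mu r r' * M r' * g r r' x) (\<Sum>r'=1..m. mu r r' * M r' * 1)"
      by (intro has_bochner_integral_sum has_bochner_integral_mult_right gint r)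
    then show ?thesis by (simp add: fpred_eq[abs_def] w_def)
  qed
  have f0: "0 \<le> fpred r x" if "r \<in> {1..m}" for r x
    unfolding fpred_eq using that by (intro sum_nonneg mult_nonneg_nonneg mu0 M0 g(1))
  have marg: "mode_marginal n fpred r = w r" if "r \<in> {1..m}" for r
    using fint[OF that] by (simp add: mode_marginal_def has_bochner_integral_iff)
  have fdens: "density_on m n fpred"
  proof -
    have "(\<Sum>r=1..m. \<integral>\<^sup>+x. ennreal (fpred r x) \<partial>?L r) = (\<Sum>r=1..m. ennreal (w r))"
      by (intro sum.cong refl nn_integral_has_bochner_integral fint f0)
    also have "\<dots> = 1" using w0 w1 by (subst sum_ennreal) auto
    finally show ?thesis
      using f0 borel_measurable_has_bochner_integral[OF fint] by (auto simp: density_on_def)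
  qed
  \<comment> \<open>For \<open>0 < w r\<close> this is the conditional predicted density given mode
    \<open>r\<close>, the mixture to which the moment and divergence lemmas apply.\<close>
  define p where "p r x = (\<Sum>r'\<in>{1..m}. alpha r r' * g r r' x)" for r x
  have alpha_eq: "alpha r r' = mu r r' * M r' / w r" for r r'
    by (simp add: alpha M_def w_def)
  have pos: "has_moments (density (?L r) (p r)) (n r) (xpred r) (Ppred r)"
    "sym_pos_def (n r) (Ppred r)" "p r \<in> borel_measurable (?L r)" "\<And>x. 0 \<le> p r x"
    "\<And>x. fpred r x = w r * p r x" if r: "r \<in> {1..m}" and wr: "0 < w r" for r
  proof -
    have a0: "0 \<le> alpha r r'" if "r' \<in> {1..m}" for r'
      unfolding alpha_eq using mu0[OF r that] M0[OF that] wr by simp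
    have a1: "(\<Sum>r'\<in>{1..m}. alpha r r') = 1"
      unfolding alpha_eq sum_divide_distrib[symmetric] w_def[symmetric] using wr by simp
    show mom: "has_moments (density (?L r) (p r)) (n r) (xpred r) (Ppred r)"
      unfolding p_def[abs_def] xpred Ppred by (rule has_moments_mixture[OF a0 a1 g(2,1,3)[OF r]])
    have x2: "xpred2 r r' - xpred r \<in> carrier_vec (n r)" if "r' \<in> {1..m}" for r'
      using has_momentsD(4)[OF mom] has_momentsD(4)[OF g(3)[OF r that]] by simp
    have P2: "sym_pos_def (n r) (Ppred2 r r')" if "r' \<in> {1..m}" for r'
      unfolding Ppred2 by (rule sym_pos_def_predicted_cov[OF xP(2)[OF that] Q[OF r that] F[OF r that]])
    show "sym_pos_def (n r) (Ppred r)"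
      unfolding Ppred by (rule sym_pos_def_mixture_cov[OF _ a0 a1 P2 x2]) simp
    show "p r \<in> borel_measurable (?L r)"
      unfolding p_def[abs_def] by (intro borel_measurable_sum borel_measurable_times g(2) r) simp_all
    show "0 \<le> p r x" for x
      unfolding p_def by (intro sum_nonneg mult_nonneg_nonneg a0 g(1) r)
    show "fpred r x = w r * p r x" for x
      using wr by (simp add: fpred_eq p_def alpha_eq sum_distrib_left)
  qed
  have qopt_eq: "qopt r x = w r * gauss (xpred r) (Ppred r) x" if "r \<in> {1..m}" for r x
    by (simp add: qopt marg[OF that])
  have qint: "has_bochner_integral (?L r) (qopt r) (w r)" if r: "r \<in> {1..m}" for r
  proof (cases "w r = 0")
    case True
    then show ?thesis by (simp add: qopt_eq[OF r, abs_def] has_bochner_integral_zero)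
  next
    case False
    then have wr: "0 < w r" using w0[OF r] by simp
    have "has_bochner_integral (?L r) (\<lambda>x. w r * gauss (xpred r) (Ppred r) x) (w r * 1)"
      by (intro has_bochner_integral_mult_right has_bochner_integral_gauss pos(2) r wr
          has_momentsD(4)[OF pos(1)])
    then show ?thesis by (simp add: qopt_eq[OF r, abs_def])
  qed
  have q0: "0 \<le> qopt r x" if r: "r \<in> {1..m}" for r x
    using w0[OF r] gauss_pos[OF pos(2)[OF r], of "xpred r" x]
    by (cases "w r = 0") (auto simp: qopt_eq[OF r] less_imp_le)
  have qmarg: "mode_marginal n qopt r = w r" if "r \<in> {1..m}" for r
    using qint[OF that] by (simp add: mode_marginal_def has_bochner_integral_iff)
  have qdens: "density_on m n qopt"
  proof -
    have "(\<Sum>r=1..m. \<integral>\<^sup>+x. ennreal (qopt r x) \<partial>?L r) = (\<Sum>r=1..m. ennreal (w r))"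
      by (intro sum.cong refl nn_integral_has_bochner_integral qint q0)
    also have "\<dots> = 1" using w0 w1 by (subst sum_ennreal) auto
    finally show ?thesis
      using q0 borel_measurable_has_bochner_integral[OF qint] by (auto simp: density_on_def)
  qed
  \<comment> \<open>Membership in the family demands a mean and a definite covariance for every
    mode. Where \<open>w r = 0\<close> the zero vector and the identity stand in, because
    \<open>Ppred r\<close> is the zero matrix there; the factor \<open>w r\<close> removes any
    effect on \<open>qopt\<close>.\<close>
  have "gaussian_given_mode m n (\<lambda>r. if w r = 0 then 0\<^sub>v (n r) else xpred r)
    (\<lambda>r. if w r = 0 then 1\<^sub>m (n r) else Ppred r) qopt"
    unfolding gaussian_given_mode_def
  proof (intro ballI)
    fix r assume r: "r \<in> {1..m}"
    show "(if w r = 0 then 0\<^sub>v (n r) else xpred r) \<in> carrier_vec (n r) \<and>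
      sym_pos_def (n r) (if w r = 0 then 1\<^sub>m (n r) else Ppred r) \<and>
      (\<forall>x\<in>carrier_vec (n r). qopt r x = mode_marginal n qopt r *
        gauss (if w r = 0 then 0\<^sub>v (n r) else xpred r) (if w r = 0 then 1\<^sub>m (n r) else Ppred r) x)"
    proof (cases "w r = 0")
      case True
      then show ?thesis by (simp add: sym_pos_def_one qmarg[OF r] qopt_eq[OF r])
    next
      case False
      then have wr: "0 < w r" using w0[OF r] by simp
      show ?thesis
        using False pos(2)[OF r wr] has_momentsD(4)[OF pos(1)[OF r wr]]
        by (simp add: qmarg[OF r] qopt_eq[OF r])
    qed
  qed
  then have qmode: "mode_gaussian_density m n qopt"
    using qdens by (auto simp: mode_gaussian_density_def)
  have "KL_hybrid m n fpred qopt \<le> KL_hybrid m n fpred y" if y: "mode_gaussian_density m n y" for y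
  proof -
    define v where "v = mode_marginal n y"
    obtain a R where yd: "density_on m n y" and ag: "gaussian_given_mode m n a R y"
      using y by (auto simp: mode_gaussian_density_def)
    have v0: "0 \<le> v r" if "r \<in> {1..m}" for r
      unfolding v_def by (rule mode_marginal_nonneg[OF yd that])
    have v1: "(\<Sum>r=1..m. v r) = 1" unfolding v_def by (rule mode_marginal_sum_eq_1[OF yd ag])
    let ?I = "\<lambda>q r. ereal_integral (?L r) (\<lambda>x. kl_integrand (fpred r x) (q r x))"
    have "?I qopt r + ereal (w r - v r) \<le> ?I y r" if r: "r \<in> {1..m}" for r
    \<comment> \<open>For \<open>w r = 0\<close> every summand of \<open>fpred r\<close> vanishes,
      so both integrals are zero and the claim reduces to \<open>- v r \<le> 0\<close>.\<close>
    proof (cases "w r = 0")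
      case True
      have z: "mu r r' * M r' = 0" if "r' \<in> {1..m}" for r'
        using True mu0[OF r] M0 that unfolding w_def
        by (subst (asm) sum_nonneg_eq_0_iff) (auto intro!: mult_nonneg_nonneg)
      have "fpred r x = 0" for x
        unfolding fpred_eq by (intro sum.neutral ballI) (simp only: z mult_zero_left)
      then show ?thesis
        using True v0[OF r] by (simp add: kl_integrand_def ereal_integral_def)
    next
      case False
      then have wr: "0 < w r" using w0[OF r] by simp
      have aR: "a r \<in> carrier_vec (n r)" "sym_pos_def (n r) (R r)"
        and yr: "\<And>x. x \<in> carrier_vec (n r) \<Longrightarrow> y r x = v r * gauss (a r) (R r) x"
        using ag r by (auto simp: gaussian_given_mode_def v_def)
      have "?I y r = ereal_integral (?L r) (\<lambda>x. kl_integrand (w r * p r x) (v r * gauss (a r) (R r) x))"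
        by (rule ereal_integral_cong) (simp add: yr pos(5)[OF r wr])
      then show ?thesis
        using ereal_integral_kl_gauss_le[OF pos(3,4,1,2)[OF r wr] aR(2,1) wr v0[OF r]]
        by (simp add: qopt_eq[OF r] pos(5)[OF r wr])
    qed
    then have "(\<Sum>r=1..m. ?I qopt r + ereal (w r - v r)) \<le> (\<Sum>r=1..m. ?I y r)"
      by (rule sum_mono)
    moreover have "(\<Sum>r=1..m. ereal (w r - v r)) = 0"
      using w1 v1 by (simp add: sum_subtractf)
    ultimately show ?thesis by (simp add: KL_hybrid_def sum.distrib)
  qed
  then have "is_arg_min (KL_hybrid m n fpred) (mode_gaussian_density m n) qopt"
    using qmode by (auto simp: is_arg_min_def not_less)
  then show ?thesis
    using fdens marg qmarg pos(2) by (auto simp: w_def M_def)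
qed

end
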